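(* Consider the standing setup below, for a full rate linear dispersive code with full rank generator matrix $\mathbf G$, multiplexing gain $r$, ML diversity gain $d(r)$ and SD complexity exponent $c(r)$, and with sphere radius $\xi^2=z\log\rho$ for a constant $z>d(r)$. For $x\in\mathbb R$ define $$g(x)=\frac{\Pr\big(\{\hat{\mathbf X}_{\mathrm{ML}}\neq \mathbf X\}\cup\{\mathcal N_\kappa=\emptyset\}\cup\{N\ge \rho^x\}\big)}{\Pr(\hat{\mathbf X}_{\mathrm{ML}}\neq\mathbf X)},$$ the ratio of the error probability of a sphere decoder that declares an error when its search set at the last layer is empty or when its node count reaches $\rho^x$, to the ML error probability. Then for every $x>c(r)$, $\lim_{\rho\to\infty} g(x)=1$.
   Context: Standing setup. Let $\rho>0$ (SNR) tend to infinity; $\log$ is base 2. For functions of $\rho$, $f(\rho)\doteq\rho^a$ means $\lim_{\rho\to\infty}\log f(\rho)/\log\rho=a$; $\dot\le,\dot\ge$ are defined with $\limsup\le a$, $\liminf\ge a$. Channel: $\mathbf Y=\mathbf H\mathbf X+\mathbf W$ with $\mathbf H\in\mathbb C^{n_r\times n_t}$ ($n_r\ge n_t$) having i.i.d. circularly symmetric complex Gaussian $\mathcal{CN}(0,1)$ entries, $\mathbf W\in\mathbb C^{n_r\times T}$ with i.i.d. $\mathcal{CN}(0,1)$ entries, independent of $\mathbf H$ and of the codeword. Full rate linear dispersive code: $\kappa=n_tT$, $\mathbf X=\theta\sum_{i=1}^\kappa s_i\mathbf D_i$ with linearly independent $\mathbf D_i\in\mathbb C^{n_t\times T}$, symbols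 $s_i$ drawn i.i.d. uniformly from $\mathcal Q_\eta=\{s\in\mathbb C:\Re s,\Im s\in\mathbb Z\cap[-\eta,\eta]\}$. The generator matrix is $\mathbf G=[\mathrm{vec}(\mathbf D_1)\cdots\mathrm{vec}(\mathbf D_\kappa)]\in\mathbb C^{\kappa\times\kappa}$ (full rank; $\mathrm{vec}$ stacks columns), so $\mathrm{vec}(\mathbf X)=\theta\mathbf G\mathbf s$. For multiplexing gain $r\in[0,n_t]$ the parameters depend on $\rho$ with $\eta\doteq\rho^{rT/(2\kappa)}$ and $\theta^2\doteq\rho^{1-rT/\kappa}$ (so that $\mathrm E\|\mathbf X\|_F^2=\rho T$). The ML decoder is $\hat{\mathbf X}_{\mathrm{ML}}=\arg\min_{\mathbf X'}\|\mathbf Y-\mathbf H\mathbf X'\|_F^2$ over the codebook, and the diversity gain is $d(r)=-\lim_{\rho\to\infty}\log\Pr(\hat{\mathbf X}_{\mathrm{ML}}\ne\mathbf X)/\log\rho$ (assumed to exist). Sphere decoder: let $\mathbf M=\theta(\mathbf I_T\otimes\mathbf H)\mathbf G$, $\mathbf y=\mathrm{vec}(\mathbf Y)$, $\mathbf M=\mathbf Q\mathbf R$ the thin QR decomposition ($\mathbf Q^H\mathbf Q=\mathbf I$, $\mathbf R\in\mathbb C^{\kappa\times\kappa}$ upper triangular), $\mathbf r=\mathbf Q^H\mathbf y$. For $k=1,\dots,\kappa$ let $\mathbf r_k$ be the last $k$ entries of $\mathbf r$ and $\mathbf R_k$ the lower-right $k\times k$ block of $\mathbf R$, and $\mathcal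 N_k=\{\hat{\mathbf s}_k\in\mathcal Q_\eta^k:\|\mathbf r_k-\mathbf R_k\hat{\mathbf s}_k\|^2\le\xi^2\}$, $N_k=|\mathcal N_k|$, and the complexity (number of visited nodes) $N=\sum_{k=1}^\kappa N_k$. The radius is $\xi^2=z\log\rho$ with a constant $z>d(r)$. Define $\Psi(x)=-\lim_{\rho\to\infty}\log\Pr(N\ge\rho^x)/\log\rho$ (assumed to exist) and the SD complexity exponent $c(r)=\inf\{x:\Psi(x)>d(r)\}$. *)

theory Defs
  imports "HOL-Probability.Probability"
begin

definition dot_eq :: "(real \<Rightarrow> real) \<Rightarrow> real \<Rightarrow> bool" where
  "dot_eq f a \<longleftrightarrow> ((\<lambda>\<rho>. log 2 (f \<rho>) / log 2 \<rho>) \<longlongrightarrow> a) at_top"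

definition decay_exp :: "(real \<Rightarrow> real) \<Rightarrow> real \<Rightarrow> ereal" where
  "decay_exp P \<rho> = (if P \<rho> = 0 then \<infinity> else ereal (- log 2 (P \<rho>) / log 2 \<rho>))"

definition QAM :: "real \<Rightarrow> complex set" where
  "QAM \<eta> = {s. Re s \<in> \<int> \<and> Im s \<in> \<int> \<and> \<bar>Re s\<bar> \<le> \<eta> \<and> \<bar>Im s\<bar> \<le> \<eta>}"

definition cn_measure :: "complex measure" where
  "cn_measure = density lborel (\<lambda>z. ennreal (exp (- (cmod z)\<^sup>2) / pi))"

(* X = theta * sum_i s_i D_i, with vec(D_j) = column j of G, vec stacking columns:
   (D_j)_{l,t} = G (t*nt + l) j ;  X indexed by (l,t), l < nt, t < T *)
definition codeword :: "nat \<Rightarrow> nat \<Rightarrow> (nat \<Rightarrow> nat \<Rightarrow> complex) \<Rightarrow> real \<Rightarrow> (nat \<Rightarrow> complex)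
    \<Rightarrow> nat \<times> nat \<Rightarrow> complex" where
  "codeword nt T G \<theta> s = (\<lambda>(l,t). of_real \<theta> * (\<Sum>j<nt*T. s j * G (t*nt + l) j))"

definition received :: "nat \<Rightarrow> nat \<Rightarrow> (nat \<Rightarrow> nat \<Rightarrow> complex) \<Rightarrow> real
    \<Rightarrow> (nat \<times> nat \<Rightarrow> complex) \<Rightarrow> (nat \<times> nat \<Rightarrow> complex) \<Rightarrow> (nat \<Rightarrow> complex) \<Rightarrow> nat \<times> nat \<Rightarrow> complex" where
  "received nt T G \<theta> H W s = (\<lambda>(i,t). (\<Sum>l<nt. H (i,l) * codeword nt T G \<theta> s (l,t)) + W (i,t))"

definition frob_dist2 :: "nat \<Rightarrow> nat \<Rightarrow> nat \<Rightarrow> (nat \<times> nat \<Rightarrow> complex) \<Rightarrow> (nat \<times> nat \<Rightarrow> complex)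
    \<Rightarrow> (nat \<times> nat \<Rightarrow> complex) \<Rightarrow> real" where
  "frob_dist2 nr nt T H Y X = (\<Sum>i<nr. \<Sum>t<T. (cmod (Y (i,t) - (\<Sum>l<nt. H (i,l) * X (l,t))))\<^sup>2)"

(* ML decoding error: some codeword different from the transmitted one is at least as
   close to Y (ties have probability zero) *)
definition ml_error :: "nat \<Rightarrow> nat \<Rightarrow> nat \<Rightarrow> (nat \<Rightarrow> nat \<Rightarrow> complex) \<Rightarrow> real \<Rightarrow> real
    \<Rightarrow> (nat \<times> nat \<Rightarrow> complex) \<Rightarrow> (nat \<times> nat \<Rightarrow> complex) \<Rightarrow> (nat \<Rightarrow> complex) \<Rightarrow> bool" where
  "ml_error nr nt T G \<eta> \<theta> H W s \<longleftrightarrow>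
     (\<exists>s' \<in> Pi\<^sub>E {..<nt*T} (\<lambda>_. QAM \<eta>).
        (\<exists>l<nt. \<exists>t<T. codeword nt T G \<theta> s' (l,t) \<noteq> codeword nt T G \<theta> s (l,t)) \<and>
        frob_dist2 nr nt T H (received nt T G \<theta> H W s) (codeword nt T G \<theta> s')
          \<le> frob_dist2 nr nt T H (received nt T G \<theta> H W s) (codeword nt T G \<theta> s))"

(* M = theta (I_T \<otimes> H) G, an (nr*T) x kappa matrix; row a = t*nr + i *)
definition sd_M :: "nat \<Rightarrow> nat \<Rightarrow> (nat \<Rightarrow> nat \<Rightarrow> complex) \<Rightarrow> real \<Rightarrow> (nat \<times> nat \<Rightarrow> complex)
    \<Rightarrow> nat \<Rightarrow> nat \<Rightarrow> complex" where
  "sd_M nr nt G \<theta> H = (\<lambda>a j. of_real \<theta> * (\<Sum>l<nt. H (a mod nr, l) * G ((a div nr)*nt + l) j))"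

definition vec_Y :: "nat \<Rightarrow> (nat \<times> nat \<Rightarrow> complex) \<Rightarrow> nat \<Rightarrow> complex" where
  "vec_Y nr Y = (\<lambda>a. Y (a mod nr, a div nr))"

definition is_thin_QR :: "nat \<Rightarrow> nat \<Rightarrow> (nat \<Rightarrow> nat \<Rightarrow> complex) \<Rightarrow> (nat \<Rightarrow> nat \<Rightarrow> complex)
    \<Rightarrow> (nat \<Rightarrow> nat \<Rightarrow> complex) \<Rightarrow> bool" where
  "is_thin_QR m n A Q R \<longleftrightarrow>
     (\<forall>a<m. \<forall>j<n. A a j = (\<Sum>b<n. Q a b * R b j)) \<and>
     (\<forall>b<n. \<forall>b'<n. (\<Sum>a<m. cnj (Q a b) * Q a b') = (if b = b' then 1 else 0)) \<and>
     (\<forall>b<n. \<forall>j<b. R b j = 0)"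

definition thin_QR :: "nat \<Rightarrow> nat \<Rightarrow> (nat \<Rightarrow> nat \<Rightarrow> complex)
    \<Rightarrow> (nat \<Rightarrow> nat \<Rightarrow> complex) \<times> (nat \<Rightarrow> nat \<Rightarrow> complex)" where
  "thin_QR m n A = (SOME QR. is_thin_QR m n A (fst QR) (snd QR))"

(* N_k = |{ s_k in Q^k : || r_k - R_k s_k ||^2 \<le> xi^2 }|, the last k coordinates being
   indexed by {kappa-k..<kappa} *)
definition sd_Nk :: "nat \<Rightarrow> nat \<Rightarrow> nat \<Rightarrow> (nat \<Rightarrow> nat \<Rightarrow> complex) \<Rightarrow> real \<Rightarrow> real \<Rightarrow> real
    \<Rightarrow> (nat \<times> nat \<Rightarrow> complex) \<Rightarrow> (nat \<times> nat \<Rightarrow> complex) \<Rightarrow> (nat \<Rightarrow> complex) \<Rightarrow> nat \<Rightarrow> nat" where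
  "sd_Nk nr nt T G \<eta> \<theta> \<xi>2 H W s k =
     (let \<kappa> = nt*T;
          QR = thin_QR (nr*T) \<kappa> (sd_M nr nt G \<theta> H);
          Q = fst QR; R = snd QR;
          y = vec_Y nr (received nt T G \<theta> H W s);
          rv = (\<lambda>b. \<Sum>a<nr*T. cnj (Q a b) * y a)
      in card {sh \<in> Pi\<^sub>E {\<kappa>-k..<\<kappa>} (\<lambda>_. QAM \<eta>).
                 (\<Sum>b\<in>{\<kappa>-k..<\<kappa>}. (cmod (rv b - (\<Sum>j\<in>{\<kappa>-k..<\<kappa>}. R b j * sh j)))\<^sup>2) \<le> \<xi>2})"

definition sd_N :: "nat \<Rightarrow> nat \<Rightarrow> nat \<Rightarrow> (nat \<Rightarrow> nat \<Rightarrow> complex) \<Rightarrow> real \<Rightarrow> real \<Rightarrow> real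
    \<Rightarrow> (nat \<times> nat \<Rightarrow> complex) \<Rightarrow> (nat \<times> nat \<Rightarrow> complex) \<Rightarrow> (nat \<Rightarrow> complex) \<Rightarrow> nat" where
  "sd_N nr nt T G \<eta> \<theta> \<xi>2 H W s = (\<Sum>k\<in>{1..nt*T}. sd_Nk nr nt T G \<eta> \<theta> \<xi>2 H W s k)"

(* joint law of (H, W, s): i.i.d. CN(0,1) entries of H and W, independent of
   s uniform on Q_eta^kappa (completed so that null-set ambiguities are harmless) *)
definition sys_measure :: "nat \<Rightarrow> nat \<Rightarrow> nat \<Rightarrow> real
    \<Rightarrow> (((nat \<times> nat \<Rightarrow> complex) \<times> (nat \<times> nat \<Rightarrow> complex)) \<times> (nat \<Rightarrow> complex)) measure" where
  "sys_measure nr nt T \<eta> = completion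
     ((PiM ({..<nr} \<times> {..<nt}) (\<lambda>_. cn_measure) \<Otimes>\<^sub>M PiM ({..<nr} \<times> {..<T}) (\<lambda>_. cn_measure))
       \<Otimes>\<^sub>M uniform_count_measure (Pi\<^sub>E {..<nt*T} (\<lambda>_. QAM \<eta>)))"

definition Pr_event :: "'a measure \<Rightarrow> ('a \<Rightarrow> bool) \<Rightarrow> real" where
  "Pr_event M P = measure M {\<omega> \<in> space M. P \<omega>}"

definition Pe_ML :: "nat \<Rightarrow> nat \<Rightarrow> nat \<Rightarrow> (nat \<Rightarrow> nat \<Rightarrow> complex) \<Rightarrow> (real \<Rightarrow> real) \<Rightarrow> (real \<Rightarrow> real)
    \<Rightarrow> real \<Rightarrow> real" where
  "Pe_ML nr nt T G \<eta> \<theta> \<rho> = Pr_event (sys_measure nr nt T (\<eta> \<rho>))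
     (\<lambda>((H,W),s). ml_error nr nt T G (\<eta> \<rho>) (\<theta> \<rho>) H W s)"

definition Pr_complexity :: "nat \<Rightarrow> nat \<Rightarrow> nat \<Rightarrow> (nat \<Rightarrow> nat \<Rightarrow> complex) \<Rightarrow> (real \<Rightarrow> real) \<Rightarrow> (real \<Rightarrow> real)
    \<Rightarrow> real \<Rightarrow> real \<Rightarrow> real \<Rightarrow> real" where
  "Pr_complexity nr nt T G \<eta> \<theta> z x \<rho> = Pr_event (sys_measure nr nt T (\<eta> \<rho>))
     (\<lambda>((H,W),s). real (sd_N nr nt T G (\<eta> \<rho>) (\<theta> \<rho>) (z * log 2 \<rho>) H W s) \<ge> \<rho> powr x)"

definition Pr_sd_fail :: "nat \<Rightarrow> nat \<Rightarrow> nat \<Rightarrow> (nat \<Rightarrow> nat \<Rightarrow> complex) \<Rightarrow> (real \<Rightarrow> real) \<Rightarrow> (real \<Rightarrow> real)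
    \<Rightarrow> real \<Rightarrow> real \<Rightarrow> real \<Rightarrow> real" where
  "Pr_sd_fail nr nt T G \<eta> \<theta> z x \<rho> = Pr_event (sys_measure nr nt T (\<eta> \<rho>))
     (\<lambda>((H,W),s). ml_error nr nt T G (\<eta> \<rho>) (\<theta> \<rho>) H W s
        \<or> sd_Nk nr nt T G (\<eta> \<rho>) (\<theta> \<rho>) (z * log 2 \<rho>) H W s (nt*T) = 0
        \<or> real (sd_N nr nt T G (\<eta> \<rho>) (\<theta> \<rho>) (z * log 2 \<rho>) H W s) \<ge> \<rho> powr x)"

end

theory Submission
  imports Defs "Jordan_Normal_Form.Determinant"
begin

text \<open>
  The failure event is the union of the ML error event with \<open>N\<^sub>\<kappa> = 0\<close> and \<open>N \<ge> \<rho>\<^sup>x\<close>, so it suffices that the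
  latter two have probability of smaller order than the ML error probability, which eventually
  exceeds \<open>\<rho>\<^bsup>-a\<^esup>\<close> for every \<open>a > d\<close>. If \<open>N\<^sub>\<kappa> = 0\<close>, then in particular the transmitted symbols lie
  outside the sphere, so by Bessel's inequality the noise has squared norm above \<open>z log \<rho>\<close>; a Chernoff
  bound makes this \<open>O(\<rho>\<^bsup>-z\<^esup>)\<close> with \<open>z > d\<close>. For the node count, some \<open>y \<le> x\<close> has \<open>\<Psi> y > d\<close>.

  The lower bound by the ML error probability needs the failure event to be measurable, although the
  node counts are defined through an arbitrarily chosen QR decomposition. The channel matrix is almost
  surely injective, and then the columns of \<open>Q\<close> agree with the Gram-Schmidt vectors up to phases,
  which do not affect the node counts. Hence the events differ from measurable ones by null sets.
\<close>

section \<open>Gram-Schmidt orthonormalisation and thin QR decompositions\<close>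

text \<open>Vectors are total functions of which only the entries below \<open>m\<close> count. The
  form is conjugate linear in the first argument, so column \<open>b\<close> of \<open>Q\<close>
  gives entry \<open>b\<close> of \<open>Q^H v\<close>.\<close>

definition inner_prod :: "nat \<Rightarrow> (nat \<Rightarrow> complex) \<Rightarrow> (nat \<Rightarrow> complex) \<Rightarrow> complex" where
  "inner_prod m u v = (\<Sum>a<m. cnj (u a) * v a)"

lemma inner_prod_sum_right:
  "inner_prod m u (\<lambda>a. \<Sum>j\<in>J. f j a) = (\<Sum>j\<in>J. inner_prod m u (f j))"
  unfolding inner_prod_def sum_distrib_left by (rule sum.swap)

lemma inner_prod_simps:
  "inner_prod m u (\<lambda>a. v a + w a) = inner_prod m u v + inner_prod m u w"
  "inner_prod m u (\<lambda>a. v a - w a) = inner_prod m u v - inner_prod m u w"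
  "inner_prod m u (\<lambda>a. c * v a) = c * inner_prod m u v"
  "inner_prod m u (\<lambda>a. v a * c) = inner_prod m u v * c"
  "inner_prod m (\<lambda>a. c * u a) v = cnj c * inner_prod m u v"
  "inner_prod m u (\<lambda>a. v a / c) = inner_prod m u v / c"
  unfolding inner_prod_def
  by (simp_all add: algebra_simps sum.distrib sum_subtractf sum_distrib_left sum_divide_distrib)

lemma inner_prod_commute: "inner_prod m v u = cnj (inner_prod m u v)"
  unfolding inner_prod_def by (simp add: mult.commute)

lemma inner_prod_self: "inner_prod m u u = of_real (\<Sum>a<m. (cmod (u a))\<^sup>2)"
  unfolding inner_prod_def by (simp only: of_real_sum complex_norm_square mult.commute)

lemma inner_prod_cong:
  "(\<And>a. a < m \<Longrightarrow> u a = u' a) \<Longrightarrow> (\<And>a. a < m \<Longrightarrow> v a = v' a) \<Longrightarrow> inner_prod m u v = inner_prod m u' v'"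
  unfolding inner_prod_def by (auto intro!: sum.cong)

text \<open>Linear independence of the first \<open>n\<close> columns, phrased as a trivial kernel
  so that the full rank hypothesis on \<open>G\<close> is literally an instance.\<close>

definition inj_cols :: "nat \<Rightarrow> nat \<Rightarrow> (nat \<Rightarrow> nat \<Rightarrow> complex) \<Rightarrow> bool" where
  "inj_cols m n A \<longleftrightarrow> (\<forall>c. (\<forall>a<m. (\<Sum>j<n. A a j * c j) = 0) \<longrightarrow> (\<forall>j<n. c j = 0))"

definition col_span :: "nat \<Rightarrow> nat \<Rightarrow> (nat \<Rightarrow> nat \<Rightarrow> complex) \<Rightarrow> (nat \<Rightarrow> complex) set" where
  "col_span m k A = {f. \<exists>c. \<forall>a<m. f a = (\<Sum>j<k. A a j * c j)}"

lemma col_span_col: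
  assumes "j < k" shows "(\<lambda>a. A a j) \<in> col_span m k A"
proof -
  have "\<forall>a<m. A a j = (\<Sum>i<k. A a i * (if i = j then 1 else 0))"
    using assms by (simp add: if_distrib sum.delta cong: if_cong)
  then show ?thesis unfolding col_span_def by (intro CollectI exI)
qed

lemma col_span_mono:
  assumes "f \<in> col_span m k A" "k \<le> l" shows "f \<in> col_span m l A"
proof -
  obtain c where c: "\<forall>a<m. f a = (\<Sum>j<k. A a j * c j)"
    using assms unfolding col_span_def by auto
  have "(\<Sum>j<k. A a j * c j) = (\<Sum>j<l. A a j * (if j < k then c j else 0))" for a
    using assms(2) by (intro sum.mono_neutral_cong_left) auto
  with c have "\<forall>a<m. f a = (\<Sum>j<l. A a j * (if j < k then c j else 0))" by simp
  then show ?thesis unfolding col_span_def by (intro CollectI exI)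
qed

lemma col_span_diff:
  assumes "f \<in> col_span m k A" "g \<in> col_span m k A" shows "(\<lambda>a. f a - g a) \<in> col_span m k A"
proof -
  obtain c d where "\<forall>a<m. f a = (\<Sum>j<k. A a j * c j)" "\<forall>a<m. g a = (\<Sum>j<k. A a j * d j)"
    using assms unfolding col_span_def by auto
  then have "\<forall>a<m. f a - g a = (\<Sum>j<k. A a j * (c j - d j))"
    by (simp add: algebra_simps sum_subtractf)
  then show ?thesis unfolding col_span_def by (intro CollectI exI)
qed

lemma col_span_scale:
  assumes "f \<in> col_span m k A" shows "(\<lambda>a. x * f a) \<in> col_span m k A"
proof -
  obtain c where "\<forall>a<m. f a = (\<Sum>j<k. A a j * c j)"
    using assms unfolding col_span_def by auto
  then have "\<forall>a<m. x * f a = (\<Sum>j<k. A a j * (x * c j))"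
    by (simp add: sum_distrib_left algebra_simps)
  then show ?thesis unfolding col_span_def by (intro CollectI exI)
qed

lemma col_span_sum:
  assumes "\<And>i. i \<in> I \<Longrightarrow> f i \<in> col_span m k A"
  shows "(\<lambda>a. \<Sum>i\<in>I. f i a) \<in> col_span m k A"
proof -
  have "\<forall>i\<in>I. \<exists>c. \<forall>a<m. f i a = (\<Sum>j<k. A a j * c j)"
    using assms unfolding col_span_def by auto
  then obtain c where "\<forall>i\<in>I. \<forall>a<m. f i a = (\<Sum>j<k. A a j * c i j)" by metis
  then have "\<forall>a<m. (\<Sum>i\<in>I. f i a) = (\<Sum>j<k. A a j * (\<Sum>i\<in>I. c i j))"
    by (simp add: sum_distrib_left) (subst sum.swap, simp)
  then show ?thesis unfolding col_span_def by (intro CollectI exI)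
qed

text \<open>Writing column \<open>b\<close> through earlier columns would produce a kernel vector
  with entry -1 at \<open>b\<close>.\<close>

lemma col_not_in_span:
  assumes inj: "inj_cols m n A" and "b < n"
  shows "(\<lambda>a. A a b) \<notin> col_span m b A"
proof
  assume "(\<lambda>a. A a b) \<in> col_span m b A"
  then obtain c where c: "\<forall>a<m. A a b = (\<Sum>j<b. A a j * c j)"
    unfolding col_span_def by auto
  define e where "e j = (if j < b then c j else if j = b then -1 else 0)" for j
  have "(\<Sum>j<n. A a j * e j) = (\<Sum>j<Suc b. A a j * e j)" for a
    using \<open>b < n\<close> by (intro sum.mono_neutral_right) (auto simp: e_def)
  then have "\<forall>a<m. (\<Sum>j<n. A a j * e j) = 0"
    using c by (simp add: e_def)
  then have "e b = 0" using inj \<open>b < n\<close> unfolding inj_cols_def by blast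
  then show False by (simp add: e_def)
qed

text \<open>Normalised Gram-Schmidt. Division by zero makes the vector 0 when the residual vanishes,
  so the function is total; recursive calls occur only at indices \<open>j < b\<close> of the
  sum.\<close>

function gs_col :: "nat \<Rightarrow> (nat \<Rightarrow> nat \<Rightarrow> complex) \<Rightarrow> nat \<Rightarrow> nat \<Rightarrow> complex" where
  "gs_col m A b =
    (let v = (\<lambda>a. A a b - (\<Sum>j<b. inner_prod m (gs_col m A j) (\<lambda>a. A a b) * gs_col m A j a))
     in (\<lambda>a. v a / of_real (sqrt (\<Sum>a<m. (cmod (v a))\<^sup>2))))"
  by auto
termination by (relation "Wellfounded.measure (\<lambda>(m, A, b). b)") auto

declare gs_col.simps [simp del]

definition gs_residual :: "nat \<Rightarrow> (nat \<Rightarrow> nat \<Rightarrow> complex) \<Rightarrow> nat \<Rightarrow> nat \<Rightarrow> complex" where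
  "gs_residual m A b a = A a b - (\<Sum>j<b. inner_prod m (gs_col m A j) (\<lambda>a. A a b) * gs_col m A j a)"

definition gs_norm :: "nat \<Rightarrow> (nat \<Rightarrow> nat \<Rightarrow> complex) \<Rightarrow> nat \<Rightarrow> real" where
  "gs_norm m A b = sqrt (\<Sum>a<m. (cmod (gs_residual m A b a))\<^sup>2)"

lemma gs_col_eq: "gs_col m A b a = gs_residual m A b a / of_real (gs_norm m A b)"
  by (subst gs_col.simps) (simp add: gs_residual_def gs_norm_def Let_def)

text \<open>All four claims go through one strong induction: a positive norm needs a nonzero
  residual, and this rests on the earlier Gram-Schmidt vectors lying in the span of the earlier
  columns.\<close>

lemma gs_col_orthonormal_aux:
  assumes inj: "inj_cols m n A" and "b < n"
  shows "gs_col m A b \<in> col_span m (Suc b) A \<and> gs_norm m A b > 0 \<and>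
    (\<forall>b'<b. inner_prod m (gs_col m A b') (gs_col m A b) = 0) \<and>
    inner_prod m (gs_col m A b) (gs_col m A b) = 1"
  using \<open>b < n\<close>
proof (induction b rule: less_induct)
  case (less b)
  let ?g = "gs_col m A" and ?v = "gs_residual m A b"
  have IH: "?g j \<in> col_span m (Suc j) A" "inner_prod m (?g j) (?g j) = 1"
    "\<And>i. i < j \<Longrightarrow> inner_prod m (?g i) (?g j) = 0" if "j < b" for j
    using less that by auto
  have ortho: "inner_prod m (?g i) (?g j) = (if i = j then 1 else 0)" if "i < b" "j < b" for i j
    using IH that inner_prod_commute[of m "?g i" "?g j"] by (cases i j rule: linorder_cases) auto
  have proj: "(\<lambda>a. \<Sum>j<b. inner_prod m (?g j) (\<lambda>a. A a b) * ?g j a) \<in> col_span m b A"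
    by (intro col_span_sum col_span_scale) (auto intro: col_span_mono IH(1))
  have span: "?v \<in> col_span m (Suc b) A"
    unfolding gs_residual_def [abs_def]
    by (intro col_span_diff col_span_col col_span_mono[OF proj]) auto
  \<comment> \<open>A vanishing residual would equate column \<open>b\<close> with its projection,
    which lies in the span of the columns before it.\<close>
  have "\<not> (\<forall>a<m. ?v a = 0)"
  proof
    assume "\<forall>a<m. ?v a = 0"
    then have "\<forall>a<m. A a b = (\<Sum>j<b. inner_prod m (?g j) (\<lambda>a. A a b) * ?g j a)"
      by (simp add: gs_residual_def)
    with proj have "(\<lambda>a. A a b) \<in> col_span m b A" by (simp add: col_span_def)
    with col_not_in_span[OF inj less.prems] show False by simp
  qed
  then obtain a where "a < m" "?v a \<noteq> 0" by auto
  then have "(\<Sum>a<m. (cmod (?v a))\<^sup>2) > 0" by (intro sum_pos2[of _ a]) auto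
  then have pos: "gs_norm m A b > 0" by (simp add: gs_norm_def)
  have nsq: "(\<Sum>a<m. (cmod (?v a))\<^sup>2) = (gs_norm m A b)\<^sup>2"
    by (simp add: gs_norm_def sum_nonneg)
  have g: "?g b = (\<lambda>a. ?v a / of_real (gs_norm m A b))" by (simp add: gs_col_eq fun_eq_iff)
  have "?g b \<in> col_span m (Suc b) A"
    using col_span_scale[OF span, of "1 / of_real (gs_norm m A b)"] by (simp add: g)
  moreover have "inner_prod m (?g i) (?g b) = 0" if "i < b" for i
  proof -
    have "inner_prod m (?g i) ?v = 0"
      unfolding gs_residual_def [abs_def] inner_prod_simps inner_prod_sum_right
      using that by (simp add: ortho if_distrib sum.delta cong: if_cong)
    then show ?thesis by (simp add: g inner_prod_simps)
  qed
  moreover have "inner_prod m (?g b) (?g b) = 1"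
    unfolding inner_prod_self using pos
    by (simp add: g norm_divide power_divide sum_divide_distrib[symmetric] nsq)
  ultimately show ?case using pos by blast
qed

lemma gs_col_orthonormal:
  assumes "inj_cols m n A" "b < n" "b' < n"
  shows "inner_prod m (gs_col m A b) (gs_col m A b') = (if b = b' then 1 else 0)"
  using gs_col_orthonormal_aux[OF assms(1)] assms(2,3)
    inner_prod_commute[of m "gs_col m A b" "gs_col m A b'"]
  by (cases b b' rule: linorder_cases) auto

text \<open>Gram-Schmidt provides a witness, so the choice operator in \<open>thin_QR\<close> does
  return a decomposition.\<close>

lemma thin_QR_exists:
  assumes inj: "inj_cols m n A"
  shows "is_thin_QR m n A (fst (thin_QR m n A)) (snd (thin_QR m n A))"
proof -
  \<comment> \<open>The projection coefficients stand above the diagonal and the residual norms on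
    it.\<close>
  define R where "R b j = (if b < j then inner_prod m (gs_col m A b) (\<lambda>a. A a j)
    else if b = j then of_real (gs_norm m A b) else 0)" for b j
  have "A a j = (\<Sum>b<n. gs_col m A b a * R b j)" if "j < n" for a j
  proof -
    have "(\<Sum>b<n. gs_col m A b a * R b j) = (\<Sum>b<Suc j. gs_col m A b a * R b j)"
      using that by (intro sum.mono_neutral_right) (auto simp: R_def)
    also have "\<dots> = (\<Sum>b<j. inner_prod m (gs_col m A b) (\<lambda>a. A a j) * gs_col m A b a)
        + gs_residual m A j a"
      using gs_col_orthonormal_aux[OF inj that] by (simp add: R_def gs_col_eq mult.commute)
    also have "\<dots> = A a j" by (simp add: gs_residual_def)
    finally show ?thesis by simp
  qed
  then have "is_thin_QR m n A (\<lambda>a b. gs_col m A b a) R"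
    using gs_col_orthonormal[OF inj] unfolding is_thin_QR_def inner_prod_def
    by (auto simp: R_def)
  then have "\<exists>QR. is_thin_QR m n A (fst QR) (snd QR)" by (metis fst_conv snd_conv)
  then show ?thesis unfolding thin_QR_def by (rule someI_ex)
qed

section \<open>Uniqueness of the thin QR decomposition up to phases\<close>

lemma thin_QR_orthonormal:
  assumes "is_thin_QR m n A Q R" "b < n" "b' < n"
  shows "inner_prod m (\<lambda>a. Q a b) (\<lambda>a. Q a b') = (if b = b' then 1 else 0)"
  using assms unfolding is_thin_QR_def inner_prod_def by auto

text \<open>Multiply \<open>A = Q R\<close> from the left by \<open>Q^H\<close>. Thus
  \<open>Q\<close> determines \<open>R\<close>, and \<open>R\<close> can be eliminated from the node
  counts.\<close>

lemma thin_QR_R_entry: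
  assumes QR: "is_thin_QR m n A Q R" and "b < n" "j < n"
  shows "inner_prod m (\<lambda>a. Q a b) (\<lambda>a. A a j) = R b j"
proof -
  have "inner_prod m (\<lambda>a. Q a b) (\<lambda>a. A a j) =
      inner_prod m (\<lambda>a. Q a b) (\<lambda>a. \<Sum>i<n. Q a i * R i j)"
    using QR \<open>j < n\<close> unfolding is_thin_QR_def by (intro inner_prod_cong) auto
  also have "\<dots> = R b j"
    using \<open>b < n\<close> thin_QR_orthonormal[OF QR \<open>b < n\<close>]
    by (simp add: inner_prod_sum_right inner_prod_simps if_distrib sum.delta cong: if_cong)
       (subst sum.cong[OF refl, of _ _ "\<lambda>i. if b = i then R i j else 0"], auto)
  finally show ?thesis .
qed

text \<open>Strong induction on the column. Phases of earlier columns cancel in the projections, so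
  the Gram-Schmidt residual of column \<open>b\<close> is \<open>R b b\<close> times column
  \<open>b\<close> of \<open>Q\<close>. The diagonal of \<open>R\<close> may be any nonzero complex
  number, hence the phase.\<close>

lemma thin_QR_unique:
  assumes inj: "inj_cols m n A" and QR: "is_thin_QR m n A Q R" and "b < n"
  shows "\<exists>u. cmod u = 1 \<and> (\<forall>a<m. Q a b = u * gs_col m A b a)"
  using \<open>b < n\<close>
proof (induction b rule: less_induct)
  case (less b)
  let ?g = "gs_col m A"
  have "(\<lambda>a. inner_prod m (?g j) (\<lambda>a. A a b) * ?g j a) a = Q a j * R j b" if "j < b" "a < m" for j a
  proof -
    obtain u where u: "cmod u = 1" "\<forall>a<m. Q a j = u * ?g j a" using less \<open>j < b\<close> by fastforce
    have uu: "cnj u * u = 1" using u(1) by (metis complex_norm_square mult.commute of_real_1 power_one)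
    have "R j b = inner_prod m (\<lambda>a. u * ?g j a) (\<lambda>a. A a b)"
      using thin_QR_R_entry[OF QR, of j b] less.prems \<open>j < b\<close> u(2)
      by (simp add: inner_prod_def)
    then have "Q a j * R j b = (cnj u * u) * (inner_prod m (?g j) (\<lambda>a. A a b) * ?g j a)"
      using u(2) \<open>a < m\<close> by (simp add: inner_prod_simps)
    then show ?thesis by (simp add: uu)
  qed
  moreover have "A a b = (\<Sum>j<b. Q a j * R j b) + Q a b * R b b" if "a < m" for a
  proof -
    have "A a b = (\<Sum>j<n. Q a j * R j b)" using QR less.prems that unfolding is_thin_QR_def by auto
    also have "\<dots> = (\<Sum>j<Suc b. Q a j * R j b)"
      using QR less.prems unfolding is_thin_QR_def by (intro sum.mono_neutral_right) auto
    finally show ?thesis by simp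
  qed
  ultimately have res: "gs_residual m A b a = Q a b * R b b" if "a < m" for a
    using that by (simp add: gs_residual_def)
  have "of_real (\<Sum>a<m. (cmod (Q a b))\<^sup>2) = (1::complex)"
    using thin_QR_orthonormal[OF QR, of b b] less.prems by (simp add: inner_prod_self)
  then have "(\<Sum>a<m. (cmod (Q a b))\<^sup>2) = 1" by (metis of_real_eq_1_iff)
  then have "gs_norm m A b = cmod (R b b)"
    by (simp add: gs_norm_def res norm_mult power_mult_distrib sum_distrib_right[symmetric])
  moreover have "gs_norm m A b > 0" using gs_col_orthonormal_aux[OF inj less.prems] by blast
  \<comment> \<open>The residual divided by its norm is \<open>R b b / cmod (R b b)\<close> times
    column \<open>b\<close> of \<open>Q\<close>; the phase is the inverse of that factor.\<close>
  ultimately have "cmod (of_real (cmod (R b b)) / R b b) = 1 \<and>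
      (\<forall>a<m. Q a b = (of_real (cmod (R b b)) / R b b) * ?g b a)"
    by (auto simp: norm_divide gs_col_eq res)
  then show ?case by blast
qed

text \<open>Split \<open>w\<close> into its projection \<open>p\<close> and the remainder
  \<open>e\<close>. Since \<open>e\<close> is orthogonal to \<open>p\<close>, the squared norm of
  \<open>w\<close> is that of \<open>e\<close> plus the sum on the left.\<close>

lemma bessel_ineq:
  fixes n :: nat
  assumes "\<And>b b'. b < n \<Longrightarrow> b' < n \<Longrightarrow> inner_prod m (q b) (q b') = (if b = b' then 1 else 0)"
  shows "(\<Sum>b<n. (cmod (inner_prod m (q b) w))\<^sup>2) \<le> (\<Sum>a<m. (cmod (w a))\<^sup>2)"
proof -
  define p where "p a = (\<Sum>b<n. inner_prod m (q b) w * q b a)" for a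
  define e where "e a = w a - p a" for a
  have qe: "inner_prod m (q b) e = 0" if "b < n" for b
  proof -
    have "inner_prod m (q b) p = (\<Sum>i<n. if b = i then inner_prod m (q i) w else 0)"
      unfolding p_def [abs_def] inner_prod_sum_right inner_prod_simps
      using assms that by (intro sum.cong) auto
    then show ?thesis unfolding e_def [abs_def] inner_prod_simps using that by (simp add: sum.delta')
  qed
  have pe: "inner_prod m e p = 0"
    unfolding p_def [abs_def] inner_prod_sum_right inner_prod_simps
    by (intro sum.neutral) (auto simp: inner_prod_commute[of m e] qe)
  have "inner_prod m w p = (\<Sum>b<n. of_real ((cmod (inner_prod m (q b) w))\<^sup>2))"
    unfolding p_def [abs_def] inner_prod_sum_right inner_prod_simps
    by (intro sum.cong refl) (subst inner_prod_commute, simp only: complex_norm_square)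
  then have wp: "inner_prod m w p = of_real (\<Sum>b<n. (cmod (inner_prod m (q b) w))\<^sup>2)" by simp
  have "inner_prod m w w = inner_prod m e e + inner_prod m w p"
  proof -
    have "inner_prod m e e = inner_prod m e w"
      using pe by (simp add: e_def [abs_def] inner_prod_simps)
    also have "\<dots> = cnj (inner_prod m w e)" by (rule inner_prod_commute)
    also have "\<dots> = cnj (inner_prod m w w - inner_prod m w p)"
      by (simp add: e_def [abs_def] inner_prod_simps)
    \<comment> \<open>Both inner products are real, so conjugation leaves them fixed.\<close>
    also have "\<dots> = inner_prod m w w - inner_prod m w p"
      by (simp only: wp inner_prod_self flip: of_real_diff) simp
    finally show ?thesis by simp
  qed
  then have "(\<Sum>a<m. (cmod (w a))\<^sup>2) =
      (\<Sum>a<m. (cmod (e a))\<^sup>2) + (\<Sum>b<n. (cmod (inner_prod m (q b) w))\<^sup>2)"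
    unfolding wp inner_prod_self by (metis of_real_add of_real_eq_iff)
  moreover have "(\<Sum>a<m. (cmod (e a))\<^sup>2) \<ge> 0" by (intro sum_nonneg) auto
  ultimately show ?thesis by linarith
qed

section \<open>Circularly symmetric Gaussian vectors\<close>

text \<open>The integrand is a constant multiple of the normal density with variance
  \<open>1 / (2 * a)\<close>.\<close>

lemma nn_integral_gaussian_real:
  fixes a :: real assumes "a > 0"
  shows "(\<integral>\<^sup>+x. ennreal (exp (- a * x\<^sup>2)) \<partial>lborel) = ennreal (sqrt (pi / a))"
proof -
  define \<sigma> where "\<sigma> = sqrt (1 / (2 * a))"
  have s: "\<sigma> > 0" "\<sigma>\<^sup>2 = 1 / (2 * a)" using assms by (auto simp: \<sigma>_def)
  have "exp (- a * x\<^sup>2) = sqrt (pi / a) * normal_density 0 \<sigma> x" for x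
    using assms by (simp add: normal_density_def s field_simps)
  then have "(\<integral>\<^sup>+x. ennreal (exp (- a * x\<^sup>2)) \<partial>lborel)
      = (\<integral>\<^sup>+x. ennreal (sqrt (pi / a)) * ennreal (normal_density 0 \<sigma> x) \<partial>lborel)"
    using assms by (simp add: ennreal_mult)
  also have "\<dots> = ennreal (sqrt (pi / a)) * (\<integral>\<^sup>+x. ennreal (normal_density 0 \<sigma> x) \<partial>lborel)"
    by (rule nn_integral_cmult) simp
  also have "(\<integral>\<^sup>+x. ennreal (normal_density 0 \<sigma> x) \<partial>lborel) = 1"
    using s by (subst nn_integral_eq_integral) auto
  finally show ?thesis by simp
qed

lemma nn_integral_gaussian_complex:
  fixes a :: real assumes "a > 0"
  shows "(\<integral>\<^sup>+z. ennreal (exp (- a * (cmod z)\<^sup>2)) \<partial>lborel) = ennreal (pi / a)"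
proof -
  have "ennreal (exp (- a * (cmod z)\<^sup>2)) = (\<Prod>b\<in>Basis. ennreal (exp (- a * (z \<bullet> b)\<^sup>2)))" for z
    by (simp add: Basis_complex_def cmod_power2 exp_add[symmetric] ennreal_mult[symmetric] algebra_simps)
  then have "(\<integral>\<^sup>+z. ennreal (exp (- a * (cmod z)\<^sup>2)) \<partial>lborel)
      = (\<Prod>b\<in>(Basis::complex set). (\<integral>\<^sup>+x. ennreal (exp (- a * x\<^sup>2)) \<partial>lborel))"
    by (subst nn_integral_lborel_prod[symmetric]) auto
  also have "\<dots> = ennreal (sqrt (pi / a)) * ennreal (sqrt (pi / a))"
    unfolding nn_integral_gaussian_real[OF assms] by (simp add: Basis_complex_def)
  also have "\<dots> = ennreal (pi / a)"
    using assms by (simp add: ennreal_mult[symmetric])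
  finally show ?thesis .
qed

section \<open>The law CN(0,1): exponential moments, Chernoff bound, null slices\<close>

lemma sets_cn_measure [measurable_cong, simp]: "sets cn_measure = sets borel"
  by (simp add: cn_measure_def)

lemma space_cn_measure [simp]: "space cn_measure = UNIV"
  by (simp add: cn_measure_def)

text \<open>The squared modulus is exponentially distributed with rate 1; this is its moment
  generating function. The case \<open>\<mu> = 0\<close> gives total mass 1.\<close>

lemma nn_integral_exp_cn_measure:
  assumes "\<mu> < 1"
  shows "(\<integral>\<^sup>+z. ennreal (exp (\<mu> * (cmod z)\<^sup>2)) \<partial>cn_measure) = ennreal (1 / (1 - \<mu>))"
proof -
  have "(\<integral>\<^sup>+z. ennreal (exp (\<mu> * (cmod z)\<^sup>2)) \<partial>cn_measure)
      = (\<integral>\<^sup>+z. ennreal (exp (- (cmod z)\<^sup>2) / pi) * ennreal (exp (\<mu> * (cmod z)\<^sup>2)) \<partial>lborel)"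
    unfolding cn_measure_def by (subst nn_integral_density) auto
  also have "\<dots> = (\<integral>\<^sup>+z. ennreal (1 / pi) * ennreal (exp (- (1 - \<mu>) * (cmod z)\<^sup>2)) \<partial>lborel)"
    by (intro nn_integral_cong)
       (simp add: ennreal_mult[symmetric] exp_add[symmetric] algebra_simps)
  also have "\<dots> = ennreal (1 / pi) * ennreal (pi / (1 - \<mu>))"
    using assms by (subst nn_integral_cmult, simp, subst nn_integral_gaussian_complex) auto
  also have "\<dots> = ennreal (1 / (1 - \<mu>))"
    using assms by (simp add: ennreal_mult[symmetric])
  finally show ?thesis .
qed

lemma prob_space_cn_measure: "prob_space cn_measure"
  using nn_integral_exp_cn_measure[of 0] by (intro prob_spaceI) simp

lemma AE_cn_measure_neq: "AE z in cn_measure. z \<noteq> c"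
  unfolding cn_measure_def by (subst AE_density) (auto intro: AE_mp[OF AE_lborel_singleton])

interpretation cn: product_prob_space "\<lambda>_. cn_measure" UNIV
  by (simp add: product_prob_space_def product_prob_space_axioms_def product_sigma_finite_def
      prob_space_cn_measure prob_space_imp_sigma_finite)

text \<open>Chernoff bound: the indicator of the tail is at most
  \<open>exp (\<mu> * (S - t))\<close>, with \<open>S\<close> the sum of squared moduli, and the
  exponential of \<open>S\<close> factors over the independent coordinates.\<close>

lemma emeasure_cn_PiM_tail:
  assumes "finite I" "0 \<le> \<mu>" "\<mu> < 1"
  shows "emeasure (PiM I (\<lambda>_. cn_measure)) {W \<in> space (PiM I (\<lambda>_. cn_measure)). t < (\<Sum>i\<in>I. (cmod (W i))\<^sup>2)}
    \<le> ennreal (exp (- \<mu> * t) * (1 / (1 - \<mu>)) ^ card I)"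
proof -
  let ?M = "PiM I (\<lambda>_. cn_measure)"
  let ?S = "{W \<in> space ?M. t < (\<Sum>i\<in>I. (cmod (W i))\<^sup>2)}"
  have S: "?S \<in> sets ?M" by measurable
  have "emeasure ?M ?S = (\<integral>\<^sup>+W. indicator ?S W \<partial>?M)" using S by simp
  also have "\<dots> \<le> (\<integral>\<^sup>+W. ennreal (exp (- \<mu> * t)) * (\<Prod>i\<in>I. ennreal (exp (\<mu> * (cmod (W i))\<^sup>2))) \<partial>?M)"
  proof (intro nn_integral_mono)
    fix W
    have "1 \<le> exp (- \<mu> * t) * (\<Prod>i\<in>I. exp (\<mu> * (cmod (W i))\<^sup>2))" if "W \<in> ?S"
    proof -
      have "\<mu> * t \<le> \<mu> * (\<Sum>i\<in>I. (cmod (W i))\<^sup>2)" using that assms by (intro mult_left_mono) auto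
      then have "1 \<le> exp (- \<mu> * t + \<mu> * (\<Sum>i\<in>I. (cmod (W i))\<^sup>2))" by simp
      also have "\<dots> = exp (- \<mu> * t) * (\<Prod>i\<in>I. exp (\<mu> * (cmod (W i))\<^sup>2))"
        using assms by (simp only: exp_add sum_distrib_left exp_sum)
      finally show ?thesis .
    qed
    then show "indicator ?S W \<le> ennreal (exp (- \<mu> * t)) * (\<Prod>i\<in>I. ennreal (exp (\<mu> * (cmod (W i))\<^sup>2)))"
      by (auto simp: indicator_def prod_ennreal ennreal_mult[symmetric] prod_nonneg)
  qed
  also have "\<dots> = ennreal (exp (- \<mu> * t)) * (\<Prod>i\<in>I. \<integral>\<^sup>+z. ennreal (exp (\<mu> * (cmod z)\<^sup>2)) \<partial>cn_measure)"
    using assms(1) cn.product_nn_integral_prod[OF assms(1), of "\<lambda>_ z. ennreal (exp (\<mu> * (cmod z)\<^sup>2))"]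
    by (subst nn_integral_cmult) auto
  also have "\<dots> = ennreal (exp (- \<mu> * t) * (1 / (1 - \<mu>)) ^ card I)"
    using assms by (simp add: nn_integral_exp_cn_measure prod_ennreal ennreal_mult[symmetric] ennreal_power)
  finally show ?thesis .
qed

text \<open>Fubini in coordinate \<open>i\<close>: every slice of \<open>N\<close> is contained in a
  single point, which has measure zero under the absolutely continuous law of that
  coordinate.\<close>

lemma null_sets_cn_PiM_slice:
  assumes "finite I" "i \<in> I" and N: "N \<in> sets (PiM I (\<lambda>_. cn_measure))"
    and slice: "\<And>x. x \<in> space (PiM (I - {i}) (\<lambda>_. cn_measure)) \<Longrightarrow> \<exists>c. \<forall>y. x(i := y) \<in> N \<longrightarrow> y = c"
  shows "N \<in> null_sets (PiM I (\<lambda>_. cn_measure))"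
proof -
  have I: "insert i (I - {i}) = I" using assms by auto
  have "emeasure (PiM I (\<lambda>_. cn_measure)) N = (\<integral>\<^sup>+x. indicator N x \<partial>PiM I (\<lambda>_. cn_measure))"
    using N by simp
  also have "\<dots> = (\<integral>\<^sup>+x. (\<integral>\<^sup>+y. indicator N (x(i := y)) \<partial>cn_measure) \<partial>PiM (I - {i}) (\<lambda>_. cn_measure))"
    using cn.product_nn_integral_insert[of "I - {i}" i "indicator N"] N assms(1) unfolding I by simp
  also have "\<dots> = (\<integral>\<^sup>+x. 0 \<partial>PiM (I - {i}) (\<lambda>_. cn_measure))"
  proof (rule nn_integral_cong)
    fix x assume "x \<in> space (PiM (I - {i}) (\<lambda>_. cn_measure))"
    then obtain c where c: "\<forall>y. x(i := y) \<in> N \<longrightarrow> y = c" using slice by blast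
    have ind: "indicator N (x(i := y)) = (0::ennreal)" if "y \<noteq> c" for y
      using c that by (metis indicator_simps(2))
    have "AE y in cn_measure. indicator N (x(i := y)) = (0::ennreal)"
      using AE_cn_measure_neq[of c] by eventually_elim (rule ind)
    then have "(\<integral>\<^sup>+y. indicator N (x(i := y)) \<partial>cn_measure) = (\<integral>\<^sup>+y. 0 \<partial>cn_measure)"
      by (rule nn_integral_cong_AE)
    then show "(\<integral>\<^sup>+y. indicator N (x(i := y)) \<partial>cn_measure) = 0" by simp
  qed
  finally show ?thesis using N by auto
qed

section \<open>Almost sure invertibility of a Gaussian matrix\<close>

text \<open>Passing to determinants turns a statement over all kernel vectors into one about a
  polynomial in the entries, which makes measurability accessible.\<close>

lemma inj_cols_iff_det: "inj_cols n n A \<longleftrightarrow> det (mat n n (\<lambda>(i,j). A i j)) \<noteq> 0"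
proof -
  let ?B = "mat n n (\<lambda>(i,j). A i j)"
  have B: "?B \<in> carrier_mat n n" by simp
  have mv: "?B *\<^sub>v v = 0\<^sub>v n \<longleftrightarrow> (\<forall>a<n. (\<Sum>j<n. A a j * v $ j) = 0)" if "v \<in> carrier_vec n" for v
    using that by (auto simp: vec_eq_iff scalar_prod_def atLeast0LessThan)
  show ?thesis
  proof
    assume inj: "inj_cols n n A"
    show "det ?B \<noteq> 0"
    proof
      assume "det ?B = 0"
      then obtain v where v: "v \<in> carrier_vec n" "v \<noteq> 0\<^sub>v n" "?B *\<^sub>v v = 0\<^sub>v n"
        using det_0_iff_vec_prod_zero_field[OF B] by blast
      then have "\<forall>j<n. v $ j = 0" using inj mv unfolding inj_cols_def by blast
      then show False using v by (auto simp: vec_eq_iff)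
    qed
  next
    assume det: "det ?B \<noteq> 0"
    show "inj_cols n n A" unfolding inj_cols_def
    proof (intro allI impI)
      fix c j assume c: "\<forall>a<n. (\<Sum>j<n. A a j * c j) = 0" and "j < n"
      have "?B *\<^sub>v vec n c = 0\<^sub>v n" using c by (subst mv) auto
      moreover have "vec n c \<in> carrier_vec n" by simp
      ultimately have "vec n c = 0\<^sub>v n" using det det_0_iff_vec_prod_zero_field[OF B] by blast
      then have "vec n c $ j = 0\<^sub>v n $ j" by simp
      then show "c j = 0" using \<open>j < n\<close> by simp
    qed
  qed
qed

lemma measurable_inj_cols:
  assumes "\<And>i j. i < n \<Longrightarrow> j < n \<Longrightarrow> (\<lambda>x. A x i j) \<in> borel_measurable M"
  shows "{x \<in> space M. inj_cols n n (A x)} \<in> sets M"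
proof -
  have "(\<lambda>x. det (mat n n (\<lambda>(i,j). A x i j))) \<in> borel_measurable M"
  proof -
    \<comment> \<open>A permutation keeps indices below \<open>n\<close>, so the Leibniz formula
      involves only entries known to be measurable.\<close>
    have "(\<Prod>i = 0..<n. mat n n (\<lambda>(i,j). A x i j) $$ (i, p i)) = (\<Prod>i = 0..<n. A x i (p i))"
      if "p permutes {0..<n}" for p x
      using permutes_in_image[OF that] by (intro prod.cong) auto
    then have "(\<lambda>x. det (mat n n (\<lambda>(i,j). A x i j))) =
      (\<lambda>x. \<Sum>p\<in>{p. p permutes {0..<n}}. signof p * (\<Prod>i = 0..<n. A x i (p i)))"
      by (subst det_def'[of _ n]) (auto intro!: ext sum.cong)
    also have "\<dots> \<in> borel_measurable M"
      using assms permutes_in_image by (intro borel_measurable_sum borel_measurable_times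
        borel_measurable_prod borel_measurable_const) fastforce
    finally show ?thesis .
  qed
  then show ?thesis unfolding inj_cols_iff_det by measurable
qed

text \<open>\<open>A\<close> and \<open>C\<close> share all entries, recorded in \<open>B\<close>,
  except the corner. Each has a kernel vector with last entry scaled to 1. The first
  \<open>n\<close> rows then determine the other entries, because the leading block is injective,
  and the last row determines the corner.\<close>

lemma inj_cols_Suc_unique:
  assumes inj: "inj_cols n n A"
    and eq: "\<And>i j. i \<le> n \<Longrightarrow> j \<le> n \<Longrightarrow> (i, j) \<noteq> (n, n) \<Longrightarrow> A i j = B i j \<and> C i j = B i j"
    and A: "\<not> inj_cols (Suc n) (Suc n) A" and C: "\<not> inj_cols (Suc n) (Suc n) C"
  shows "A n n = C n n"
proof -
  have ker: "\<exists>c. \<forall>i\<le>n. (\<Sum>j<n. B i j * c j) + (if i = n then D n n else B i n) = 0"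
    if D: "\<not> inj_cols (Suc n) (Suc n) D"
      "\<And>i j. i \<le> n \<Longrightarrow> j \<le> n \<Longrightarrow> (i, j) \<noteq> (n, n) \<Longrightarrow> D i j = B i j" for D
  proof -
    obtain c where c: "\<forall>a<Suc n. (\<Sum>j<Suc n. D a j * c j) = 0" "\<exists>j<Suc n. c j \<noteq> 0"
      using D(1) unfolding inj_cols_def by blast
    have s: "(\<Sum>j<n. D i j * f j) = (\<Sum>j<n. B i j * f j)" if "i \<le> n" for i f
      using that D(2) by (intro sum.cong) auto
    \<comment> \<open>If the last entry were zero, the remaining ones would be a nonzero kernel
      vector of the leading block.\<close>
    have "c n \<noteq> 0"
    proof
      assume "c n = 0"
      then have "\<forall>a<n. (\<Sum>j<n. A a j * c j) = 0"
      proof (intro allI impI)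
        fix a assume "a < n"
        then have "(\<Sum>j<n. A a j * c j) = (\<Sum>j<n. B a j * c j)" using eq by (intro sum.cong) auto
        also have "\<dots> = 0" using c(1) \<open>a < n\<close> \<open>c n = 0\<close> s[of a c] by auto
        finally show "(\<Sum>j<n. A a j * c j) = 0" .
      qed
      then have "\<forall>j<n. c j = 0" using inj unfolding inj_cols_def by blast
      then show False using c(2) \<open>c n = 0\<close> by (metis less_SucE)
    qed
    have "\<forall>i\<le>n. (\<Sum>j<n. B i j * (c j / c n)) + (if i = n then D n n else B i n) = 0"
    proof (intro allI impI)
      fix i assume "i \<le> n"
      have "(\<Sum>j<n. B i j * c j) + D i n * c n = 0" using c(1)[rule_format, of i] s[of i c] \<open>i \<le> n\<close> by simp
      then have "((\<Sum>j<n. B i j * c j) + D i n * c n) / c n = 0" by simp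
      then have "(\<Sum>j<n. B i j * (c j / c n)) + D i n = 0"
        using \<open>c n \<noteq> 0\<close> by (simp add: add_divide_distrib sum_divide_distrib)
      then show "(\<Sum>j<n. B i j * (c j / c n)) + (if i = n then D n n else B i n) = 0"
        using D(2)[of i n] \<open>i \<le> n\<close> by auto
    qed
    then show ?thesis by (intro exI[of _ "\<lambda>j. c j / c n"])
  qed
  obtain c where c: "\<forall>i\<le>n. (\<Sum>j<n. B i j * c j) + (if i = n then A n n else B i n) = 0"
    using ker[OF A conjunct1[OF eq]] by auto
  obtain d where d: "\<forall>i\<le>n. (\<Sum>j<n. B i j * d j) + (if i = n then C n n else B i n) = 0"
    using ker[OF C conjunct2[OF eq]] by auto
  have "(\<Sum>j<n. A a j * (c j - d j)) = 0" if "a < n" for a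
  proof -
    have "(\<Sum>j<n. A a j * (c j - d j)) = (\<Sum>j<n. B a j * (c j - d j))"
      using eq that by (intro sum.cong) auto
    also have "\<dots> = ((\<Sum>j<n. B a j * c j) + B a n) - ((\<Sum>j<n. B a j * d j) + B a n)"
      by (simp add: algebra_simps sum_subtractf)
    also have "\<dots> = 0" using c[rule_format, of a] d[rule_format, of a] that by simp
    finally show ?thesis .
  qed
  then have "\<forall>j<n. c j - d j = 0"
    by (intro mp[OF spec[OF inj[unfolded inj_cols_def], of "\<lambda>j. c j - d j"]]) simp
  then have "(\<Sum>j<n. B n j * c j) = (\<Sum>j<n. B n j * d j)" by (intro sum.cong) auto
  then show ?thesis using c[rule_format, of n] d[rule_format, of n] by (simp add: add_eq_0_iff)
qed

text \<open>
  Once the leading block of size \<open>n\<close> is invertible, the next one is singular for at most one value of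
  its corner entry.
\<close>
lemma AE_inj_cols_cn:
  assumes "finite I" "{..<n} \<times> {..<n} \<subseteq> I"
  shows "AE H in PiM I (\<lambda>_. cn_measure). inj_cols n n (\<lambda>i l. H (i,l))"
  using assms(2)
proof (induction n)
  case 0 show ?case by (simp add: inj_cols_def)
next
  case (Suc n)
  let ?M = "PiM I (\<lambda>_. cn_measure)"
  let ?P = "\<lambda>n H. inj_cols n n (\<lambda>i l. H (i,l))"
  \<comment> \<open>The matrices for which invertibility is lost in passing from size
    \<open>n\<close> to \<open>Suc n\<close>.\<close>
  let ?N = "{H \<in> space ?M. ?P n H} - {H \<in> space ?M. ?P (Suc n) H}"
  have meas: "{H \<in> space ?M. ?P k H} \<in> sets ?M" if "{..<k} \<times> {..<k} \<subseteq> I" for k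
  proof (rule measurable_inj_cols)
    fix i j assume "i < k" "j < k"
    with that have "(i,j) \<in> I" by auto
    then show "(\<lambda>H. H (i,j)) \<in> borel_measurable ?M"
      by (subst measurable_cong_sets[OF refl sets_cn_measure, symmetric])
         (rule measurable_component_singleton)
  qed
  have sub: "{..<n} \<times> {..<n} \<subseteq> I" "(n,n) \<in> I" using Suc.prems by auto
  have "?N \<in> null_sets ?M"
  proof (rule null_sets_cn_PiM_slice[OF assms(1) sub(2)])
    show "?N \<in> sets ?M" using meas sub(1) Suc.prems by (intro sets.Diff) auto
    fix x
    have uniq: "y = y'" if "x((n,n) := y) \<in> ?N" "x((n,n) := y') \<in> ?N" for y y'
    proof -
      have "(\<lambda>i l. (x((n,n) := y)) (i,l)) n n = (\<lambda>i l. (x((n,n) := y')) (i,l)) n n"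
      proof (rule inj_cols_Suc_unique[where B = "\<lambda>i l. x (i,l)" and A = "\<lambda>i l. (x((n,n) := y)) (i,l)"
            and C = "\<lambda>i l. (x((n,n) := y')) (i,l)"])
        show "inj_cols n n (\<lambda>i l. (x((n,n) := y)) (i,l))" using that by blast
        show "\<not> inj_cols (Suc n) (Suc n) (\<lambda>i l. (x((n,n) := y)) (i,l))" using that by blast
        show "\<not> inj_cols (Suc n) (Suc n) (\<lambda>i l. (x((n,n) := y')) (i,l))" using that by blast
      qed auto
      then show ?thesis by simp
    qed
    show "\<exists>c. \<forall>y. x((n,n) := y) \<in> ?N \<longrightarrow> y = c"
    proof (cases "\<exists>c. x((n,n) := c) \<in> ?N")
      case True
      then obtain c where "x((n,n) := c) \<in> ?N" ..
      then show ?thesis by (intro exI[of _ c] allI impI) (rule uniq)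
    next
      case False
      \<comment> \<open>The slice is empty here, so 0 is an arbitrary choice.\<close>
      then show ?thesis by (intro exI[of _ 0] allI impI) (erule (1) notE[OF _ exI])
    qed
  qed
  then have "AE H in ?M. H \<notin> ?N" by (rule AE_not_in)
  with Suc.IH[OF sub(1)] AE_space show ?case by eventually_elim auto
qed

section \<open>Node counts of the sphere decoder\<close>

lemma finite_QAM: "finite (QAM \<eta>)"
proof -
  let ?K = "{- \<lceil>\<eta>\<rceil>..\<lceil>\<eta>\<rceil>}"
  have "QAM \<eta> \<subseteq> (\<lambda>(a,b). Complex (of_int a) (of_int b)) ` (?K \<times> ?K)"
  proof
    fix s assume "s \<in> QAM \<eta>"
    then obtain a b where ab: "Re s = of_int a" "Im s = of_int b" "\<bar>Re s\<bar> \<le> \<eta>" "\<bar>Im s\<bar> \<le> \<eta>"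
      by (auto simp: QAM_def elim!: Ints_cases)
    have "a \<in> ?K" "b \<in> ?K" using ab by (auto simp: abs_le_iff) linarith+
    moreover have "s = Complex (of_int a) (of_int b)" using ab by (simp add: complex_eq_iff)
    ultimately show "s \<in> (\<lambda>(a,b). Complex (of_int a) (of_int b)) ` (?K \<times> ?K)" by auto
  qed
  then show ?thesis by (rule finite_subset) auto
qed

lemma zero_in_QAM: "0 \<le> \<eta> \<Longrightarrow> 0 \<in> QAM \<eta>"
  by (simp add: QAM_def)

section \<open>Vectorised indices and the channel matrix M\<close>

lemma block_index_less: "(t::nat) < T \<Longrightarrow> i < n \<Longrightarrow> t * n + i < n * T"
proof -
  assume "t < T" "i < n"
  then have "t * n + i < Suc t * n" by simp
  also have "\<dots> \<le> T * n" using \<open>t < T\<close> by (intro mult_le_mono1) simp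
  finally show ?thesis by (simp add: mult.commute)
qed

text \<open>Column stacking puts entry \<open>(i,t)\<close> at position \<open>t * n + i\<close>;
  \<open>mod\<close> and \<open>div\<close> invert this.\<close>

lemma sum_blocks:
  fixes f :: "nat \<Rightarrow> nat \<Rightarrow> 'a::comm_monoid_add"
  assumes "0 < n"
  shows "(\<Sum>a<n*T. f (a mod n) (a div n)) = (\<Sum>(i,t)\<in>{..<n} \<times> {..<T}. f i t)"
proof (rule sum.reindex_bij_witness[where i = "\<lambda>(i,t). t * n + i" and j = "\<lambda>a. (a mod n, a div n)"])
  fix p assume "p \<in> {..<n} \<times> {..<T}"
  then show "(case p of (i,t) \<Rightarrow> t * n + i) \<in> {..<n*T}" by (auto intro: block_index_less)
qed (use assms in \<open>auto simp: less_mult_imp_div_less mult.commute\<close>)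

text \<open>Regroups the product as \<open>theta (I_T \<otimes> H) (G c)\<close>, separating the
  actions of \<open>G\<close> and \<open>H\<close>.\<close>

lemma sd_M_mult:
  "(\<Sum>j<k. sd_M nr nt G \<theta> H a j * c j) =
    of_real \<theta> * (\<Sum>l<nt. H (a mod nr, l) * (\<Sum>j<k. G ((a div nr) * nt + l) j * c j))"
proof -
  have "(\<Sum>j<k. sd_M nr nt G \<theta> H a j * c j) =
      (\<Sum>j<k. \<Sum>l<nt. of_real \<theta> * (H (a mod nr, l) * (G ((a div nr) * nt + l) j * c j)))"
    by (simp add: sd_M_def sum_distrib_left sum_distrib_right mult_ac)
  also have "\<dots> = (\<Sum>l<nt. \<Sum>j<k. of_real \<theta> * (H (a mod nr, l) * (G ((a div nr) * nt + l) j * c j)))"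
    by (rule sum.swap)
  finally show ?thesis by (simp add: sum_distrib_left)
qed

text \<open>At the transmitted symbols the residual of the received vector is exactly the vectorised
  noise.\<close>

lemma received_minus_sd_M:
  "vec_Y nr (received nt T G \<theta> H W s) a - (\<Sum>j<nt*T. sd_M nr nt G \<theta> H a j * s j) = W (a mod nr, a div nr)"
  unfolding sd_M_mult
  by (simp add: vec_Y_def received_def codeword_def sum_distrib_left mult_ac)

text \<open>Block \<open>t\<close> of \<open>M c\<close> is \<open>H\<close> applied to block
  \<open>t\<close> of \<open>G c\<close>, up to the factor \<open>\<theta>\<close>. Invertibility of
  the top square block of \<open>H\<close> makes every block of \<open>G c\<close> zero, and then
  \<open>c\<close> vanishes since \<open>G\<close> is injective.\<close>

lemma inj_cols_sd_M:
  assumes H: "inj_cols nt nt (\<lambda>i l. H (i,l))" and G: "inj_cols (nt*T) (nt*T) G"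
    and "nt \<le> nr" "\<theta> \<noteq> 0"
  shows "inj_cols (nr*T) (nt*T) (sd_M nr nt G \<theta> H)"
  unfolding inj_cols_def
proof (rule allI, rule impI)
  fix c assume c: "\<forall>a<nr*T. (\<Sum>j<nt*T. sd_M nr nt G \<theta> H a j * c j) = 0"
  define u where "u a = (\<Sum>j<nt*T. G a j * c j)" for a
  have u0: "u (t * nt + l) = 0" if "t < T" "l < nt" for t l
  proof -
    have "\<forall>i<nt. (\<Sum>l<nt. H (i,l) * u (t * nt + l)) = 0"
    proof (intro allI impI)
      fix i assume "i < nt"
      then have "i < nr" using assms by simp
      then have "t * nr + i < nr * T" using \<open>t < T\<close> by (intro block_index_less)
      then have "(\<Sum>j<nt*T. sd_M nr nt G \<theta> H (t * nr + i) j * c j) = 0" using c by blast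
      then show "(\<Sum>l<nt. H (i,l) * u (t * nt + l)) = 0"
        using \<open>i < nr\<close> \<open>\<theta> \<noteq> 0\<close> unfolding sd_M_mult u_def by simp
    qed
    then have "\<forall>l<nt. u (t * nt + l) = 0"
      by (intro mp[OF spec[OF H[unfolded inj_cols_def], of "\<lambda>l. u (t * nt + l)"]])
    then show ?thesis using that by blast
  qed
  have "\<forall>a<nt*T. u a = 0"
  proof (intro allI impI)
    fix a assume "a < nt * T"
    then have "a div nt < T" "a mod nt < nt"
      by (auto simp: less_mult_imp_div_less mult.commute intro!: mod_less_divisor Nat.gr0I)
    then show "u a = 0" using u0[of "a div nt" "a mod nt"] by simp
  qed
  then show "\<forall>j<nt*T. c j = 0" using G unfolding inj_cols_def u_def by blast
qed

text \<open>
  The node count with the explicit Gram-Schmidt vectors in place of the chosen \<open>Q\<close>; unlike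
  \<^const>\<open>sd_Nk\<close> it depends measurably on the channel and the noise.
\<close>
definition gs_Nk :: "nat \<Rightarrow> nat \<Rightarrow> (nat \<Rightarrow> nat \<Rightarrow> complex) \<Rightarrow> real \<Rightarrow> real \<Rightarrow> (nat \<Rightarrow> complex) \<Rightarrow> nat \<Rightarrow> nat" where
  "gs_Nk m n A \<eta> \<xi>2 y k = card {sh \<in> Pi\<^sub>E {n-k..<n} (\<lambda>_. QAM \<eta>).
     (\<Sum>b\<in>{n-k..<n}. (cmod (inner_prod m (gs_col m A b) (\<lambda>a. y a - (\<Sum>j\<in>{n-k..<n}. A a j * sh j))))\<^sup>2) \<le> \<xi>2}"

text \<open>By \<open>thin_QR_R_entry\<close> each residual coordinate is an inner product of a
  column of \<open>Q\<close> with \<open>y - A sh\<close>. Replacing that column by the Gram-Schmidt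
  vector changes it by a unit factor, invisible to \<open>cmod\<close>.\<close>

lemma sd_Nk_eq_gs_Nk:
  assumes inj: "inj_cols (nr*T) (nt*T) (sd_M nr nt G \<theta> H)"
  shows "sd_Nk nr nt T G \<eta> \<theta> \<xi>2 H W s k =
    gs_Nk (nr*T) (nt*T) (sd_M nr nt G \<theta> H) \<eta> \<xi>2 (vec_Y nr (received nt T G \<theta> H W s)) k"
proof -
  let ?A = "sd_M nr nt G \<theta> H" and ?n = "nt*T" and ?m = "nr*T"
  let ?y = "vec_Y nr (received nt T G \<theta> H W s)"
  let ?J = "{?n-k..<?n}"
  define Q where "Q = fst (thin_QR ?m ?n ?A)"
  define R where "R = snd (thin_QR ?m ?n ?A)"
  have QR: "is_thin_QR ?m ?n ?A Q R" unfolding Q_def R_def by (rule thin_QR_exists[OF inj])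
  have "cmod ((\<Sum>a<?m. cnj (Q a b) * ?y a) - (\<Sum>j\<in>?J. R b j * sh j)) =
      cmod (inner_prod ?m (gs_col ?m ?A b) (\<lambda>a. ?y a - (\<Sum>j\<in>?J. ?A a j * sh j)))"
    if "b < ?n" for b sh
  proof -
    obtain u where u: "cmod u = 1" "\<forall>a<?m. Q a b = u * gs_col ?m ?A b a"
      using thin_QR_unique[OF inj QR \<open>b < ?n\<close>] by blast
    have "(\<Sum>j\<in>?J. R b j * sh j) = (\<Sum>j\<in>?J. inner_prod ?m (\<lambda>a. Q a b) (\<lambda>a. ?A a j) * sh j)"
      using thin_QR_R_entry[OF QR \<open>b < ?n\<close>] by (intro sum.cong) auto
    then have "(\<Sum>a<?m. cnj (Q a b) * ?y a) - (\<Sum>j\<in>?J. R b j * sh j)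
        = inner_prod ?m (\<lambda>a. Q a b) (\<lambda>a. ?y a - (\<Sum>j\<in>?J. ?A a j * sh j))"
      by (simp add: inner_prod_simps inner_prod_sum_right) (simp add: inner_prod_def)
    also have "\<dots> = inner_prod ?m (\<lambda>a. u * gs_col ?m ?A b a) (\<lambda>a. ?y a - (\<Sum>j\<in>?J. ?A a j * sh j))"
      using u(2) by (intro inner_prod_cong) auto
    finally show ?thesis using u(1) by (simp add: inner_prod_simps(5) norm_mult)
  qed
  then have "(\<Sum>b\<in>?J. (cmod ((\<Sum>a<?m. cnj (Q a b) * ?y a) - (\<Sum>j\<in>?J. R b j * sh j)))\<^sup>2) =
      (\<Sum>b\<in>?J. (cmod (inner_prod ?m (gs_col ?m ?A b) (\<lambda>a. ?y a - (\<Sum>j\<in>?J. ?A a j * sh j))))\<^sup>2)" for sh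
    by (intro sum.cong) auto
  then show ?thesis unfolding sd_Nk_def gs_Nk_def Let_def Q_def[symmetric] R_def[symmetric] by simp
qed

text \<open>The transmitted vector is itself a candidate at the last layer. If it is rejected, the
  projected noise leaves the sphere, and by Bessel so does the full noise.\<close>

lemma sd_Nk_empty_imp_noise:
  assumes inj: "inj_cols (nr*T) (nt*T) (sd_M nr nt G \<theta> H)" and "0 < nr"
    and s: "s \<in> Pi\<^sub>E {..<nt*T} (\<lambda>_. QAM \<eta>)"
    and empty: "sd_Nk nr nt T G \<eta> \<theta> \<xi>2 H W s (nt*T) = 0"
  shows "\<xi>2 < (\<Sum>p\<in>{..<nr}\<times>{..<T}. (cmod (W p))\<^sup>2)"
proof -
  let ?A = "sd_M nr nt G \<theta> H" and ?n = "nt*T" and ?m = "nr*T"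
  let ?y = "vec_Y nr (received nt T G \<theta> H W s)"
  let ?w = "\<lambda>a. W (a mod nr, a div nr)"
  let ?S = "{sh \<in> Pi\<^sub>E {..<?n} (\<lambda>_. QAM \<eta>).
     (\<Sum>b<?n. (cmod (inner_prod ?m (gs_col ?m ?A b) (\<lambda>a. ?y a - (\<Sum>j<?n. ?A a j * sh j))))\<^sup>2) \<le> \<xi>2}"
  have "card ?S = 0"
    using empty unfolding sd_Nk_eq_gs_Nk[OF inj] gs_Nk_def by (simp add: atLeast0LessThan)
  moreover have "finite ?S" by (intro finite_subset[OF _ finite_PiE[of "{..<?n}" "\<lambda>_. QAM \<eta>"]]) (auto simp: finite_QAM)
  ultimately have "?S = {}" by simp
  then have "\<xi>2 < (\<Sum>b<?n. (cmod (inner_prod ?m (gs_col ?m ?A b) (\<lambda>a. ?y a - (\<Sum>j<?n. ?A a j * s j))))\<^sup>2)"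
    using s by (auto simp: not_le)
  also have "\<dots> = (\<Sum>b<?n. (cmod (inner_prod ?m (gs_col ?m ?A b) ?w))\<^sup>2)"
    by (simp only: received_minus_sd_M)
  also have "\<dots> \<le> (\<Sum>a<?m. (cmod (?w a))\<^sup>2)"
    by (rule bessel_ineq) (rule gs_col_orthonormal[OF inj])
  also have "\<dots> = (\<Sum>(i,t)\<in>{..<nr}\<times>{..<T}. (cmod (W (i,t)))\<^sup>2)"
    using sum_blocks[OF \<open>0 < nr\<close>, of "\<lambda>i t. (cmod (W (i,t)))\<^sup>2" T] .
  finally show ?thesis by (simp add: case_prod_unfold)
qed

section \<open>Measurability of Gram-Schmidt vectors and node counts\<close>

lemma borel_measurable_inner_prod:
  assumes "\<And>a. a < m \<Longrightarrow> (\<lambda>x. u x a) \<in> borel_measurable M" "\<And>a. a < m \<Longrightarrow> (\<lambda>x. v x a) \<in> borel_measurable M"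
  shows "(\<lambda>x. inner_prod m (u x) (v x)) \<in> borel_measurable M"
  unfolding inner_prod_def
proof (rule borel_measurable_sum)
  fix a assume "a \<in> {..<m}"
  then have [measurable]: "(\<lambda>x. u x a) \<in> borel_measurable M" "(\<lambda>x. v x a) \<in> borel_measurable M"
    using assms by auto
  have "(\<lambda>x. cnj (u x a)) \<in> borel_measurable M"
    by (rule borel_measurable_continuous_on[where f = cnj]) (auto intro: continuous_intros)
  then show "(\<lambda>x. cnj (u x a) * v x a) \<in> borel_measurable M" by measurable
qed

lemma borel_measurable_gs_col:
  assumes A: "\<And>a j. a < m \<Longrightarrow> j < n \<Longrightarrow> (\<lambda>x. A x a j) \<in> borel_measurable M"
    and "b < n" "a < m"
  shows "(\<lambda>x. gs_col m (A x) b a) \<in> borel_measurable M"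
  using assms(2,3)
proof (induction b arbitrary: a rule: less_induct)
  case (less b)
  have res: "(\<lambda>x. gs_residual m (A x) b a) \<in> borel_measurable M" if "a < m" for a
    unfolding gs_residual_def using less that A
    by (intro borel_measurable_diff borel_measurable_sum borel_measurable_times
        borel_measurable_inner_prod) auto
  have "(\<lambda>x. (cmod (gs_residual m (A x) b a))\<^sup>2) \<in> borel_measurable M" if "a < m" for a
    using res[OF that] by measurable
  then have "(\<lambda>x. \<Sum>a<m. (cmod (gs_residual m (A x) b a))\<^sup>2) \<in> borel_measurable M"
    by (intro borel_measurable_sum) auto
  then have [measurable]: "(\<lambda>x. gs_norm m (A x) b) \<in> borel_measurable M"
    unfolding gs_norm_def by measurable
  have [measurable]: "(\<lambda>x. gs_residual m (A x) b a) \<in> borel_measurable M" using res less.prems by auto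
  show ?case unfolding gs_col_eq by measurable
qed

lemma borel_measurable_gs_Nk:
  assumes A: "\<And>a j. a < m \<Longrightarrow> j < n \<Longrightarrow> (\<lambda>x. A x a j) \<in> borel_measurable M"
    and y: "\<And>a. a < m \<Longrightarrow> (\<lambda>x. y x a) \<in> borel_measurable M"
  shows "(\<lambda>x. real (gs_Nk m n (A x) \<eta> \<xi>2 (y x) k)) \<in> borel_measurable M"
proof -
  let ?J = "{n-k..<n}"
  let ?S = "Pi\<^sub>E ?J (\<lambda>_. QAM \<eta>)"
  define F where "F x sh = (\<Sum>b\<in>?J. (cmod (inner_prod m (gs_col m (A x) b)
    (\<lambda>a. y x a - (\<Sum>j\<in>?J. A x a j * sh j))))\<^sup>2)" for x sh
  have fin: "finite ?S" by (intro finite_PiE) (auto simp: finite_QAM)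
  have F: "(\<lambda>x. F x sh) \<in> borel_measurable M" for sh
    unfolding F_def
  proof (rule borel_measurable_sum)
    fix b assume "b \<in> ?J"
    then have "(\<lambda>x. inner_prod m (gs_col m (A x) b) (\<lambda>a. y x a - (\<Sum>j\<in>?J. A x a j * sh j))) \<in> borel_measurable M"
      using A y by (intro borel_measurable_inner_prod borel_measurable_gs_col[of m n] borel_measurable_diff
        borel_measurable_sum borel_measurable_times borel_measurable_const) auto
    then show "(\<lambda>x. (cmod (inner_prod m (gs_col m (A x) b) (\<lambda>a. y x a - (\<Sum>j\<in>?J. A x a j * sh j))))\<^sup>2)
      \<in> borel_measurable M" by measurable
  qed
  \<comment> \<open>The count is a finite sum of indicators over a candidate set that does not
    depend on \<open>x\<close>.\<close>
  have "real (gs_Nk m n (A x) \<eta> \<xi>2 (y x) k) = (\<Sum>sh\<in>?S. if F x sh \<le> \<xi>2 then 1 else 0)" for x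
    using fin unfolding gs_Nk_def F_def[symmetric] by (simp add: sum.If_cases Int_def)
  moreover have "(\<lambda>x. \<Sum>sh\<in>?S. if F x sh \<le> \<xi>2 then 1 else (0::real)) \<in> borel_measurable M"
    using F by measurable
  ultimately show ?thesis by simp
qed

section \<open>Events of the transmission system\<close>

text \<open>With finitely many symbol vectors, an event is a finite union of slices, so
  measurability may be checked for each fixed \<open>s\<close>.\<close>

lemma sets_pair_finite_snd:
  assumes "finite S" "\<And>s. s \<in> S \<Longrightarrow> {x \<in> space M. P x s} \<in> sets M"
  shows "{\<omega> \<in> space (M \<Otimes>\<^sub>M uniform_count_measure S). P (fst \<omega>) (snd \<omega>)}
    \<in> sets (M \<Otimes>\<^sub>M uniform_count_measure S)"
proof -
  have "{\<omega> \<in> space (M \<Otimes>\<^sub>M uniform_count_measure S). P (fst \<omega>) (snd \<omega>)}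
      = (\<Union>s\<in>S. {x \<in> space M. P x s} \<times> {s})"
    by (auto simp: space_pair_measure space_uniform_count_measure)
  also have "\<dots> \<in> sets (M \<Otimes>\<^sub>M uniform_count_measure S)"
    using assms by (intro sets.finite_UN pair_measureI) (auto simp: sets_uniform_count_measure)
  finally show ?thesis .
qed

text \<open>Used to replace the node counts from the chosen \<open>Q\<close> by the Gram-Schmidt
  counts outside a null set.\<close>

lemma sets_completion_AE_eq:
  assumes "AE x in M. P x \<longleftrightarrow> Q x" "{x \<in> space M. Q x} \<in> sets M"
  shows "{x \<in> space (completion M). P x} \<in> sets (completion M)"
proof (rule completion.in_sets_AE)
  show "{x \<in> space M. Q x} \<in> sets (completion M)" using assms(2) by (rule sets_completionI_sets)
  show "AE x in completion M. x \<in> {x \<in> space M. Q x} \<longleftrightarrow> x \<in> {x \<in> space (completion M). P x}"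
    using AE_completion[OF assms(1)] by eventually_elim auto
qed simp

definition chan_measure :: "nat \<Rightarrow> nat \<Rightarrow> nat \<Rightarrow> ((nat \<times> nat \<Rightarrow> complex) \<times> (nat \<times> nat \<Rightarrow> complex)) measure" where
  "chan_measure nr nt T = PiM ({..<nr} \<times> {..<nt}) (\<lambda>_. cn_measure) \<Otimes>\<^sub>M PiM ({..<nr} \<times> {..<T}) (\<lambda>_. cn_measure)"

lemma sys_measure_eq: "sys_measure nr nt T \<eta> =
  completion (chan_measure nr nt T \<Otimes>\<^sub>M uniform_count_measure (Pi\<^sub>E {..<nt*T} (\<lambda>_. QAM \<eta>)))"
  by (simp add: sys_measure_def chan_measure_def)

lemma prob_space_cn_PiM: "prob_space (PiM I (\<lambda>_. cn_measure))"
  by (rule prob_space_PiM) (rule prob_space_cn_measure)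

lemma prob_space_chan_measure: "prob_space (chan_measure nr nt T)"
  unfolding chan_measure_def by (intro prob_space_pair prob_space_cn_PiM)

lemma prob_space_symbols:
  assumes "0 < \<eta>" shows "prob_space (uniform_count_measure (Pi\<^sub>E {..<n::nat} (\<lambda>_. QAM \<eta>)))"
  using assms zero_in_QAM[of \<eta>]
  by (intro prob_space_uniform_count_measure finite_PiE) (auto simp: finite_QAM PiE_eq_empty_iff)

lemma AE_fst_pair:
  assumes "prob_space N" "AE x in M. P x"
  shows "AE \<omega> in M \<Otimes>\<^sub>M N. P (fst \<omega>)"
proof (rule AE_distrD[OF measurable_fst])
  show "AE x in distr (M \<Otimes>\<^sub>M N) M fst. P x"
    unfolding prob_space.distr_pair_fst[OF assms(1)] by (rule assms(2))
qed

text \<open>Concerns the top square block of \<open>H\<close>, which exists as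
  \<open>nt \<le> nr\<close>; the almost sure statement is lifted from \<open>H\<close> through both
  products.\<close>

lemma AE_channel_inj:
  assumes "0 < \<eta>" "nt \<le> nr"
  shows "AE \<omega> in chan_measure nr nt T \<Otimes>\<^sub>M uniform_count_measure (Pi\<^sub>E {..<nt*T} (\<lambda>_. QAM \<eta>)).
    inj_cols nt nt (\<lambda>i l. fst (fst \<omega>) (i,l))"
proof -
  have "AE H in PiM ({..<nr} \<times> {..<nt}) (\<lambda>_. cn_measure). inj_cols nt nt (\<lambda>i l. H (i,l))"
    using assms by (intro AE_inj_cols_cn) auto
  then have "AE \<omega> in chan_measure nr nt T. inj_cols nt nt (\<lambda>i l. fst \<omega> (i,l))"
    unfolding chan_measure_def by (rule AE_fst_pair[OF prob_space_cn_PiM])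
  then show ?thesis by (rule AE_fst_pair[OF prob_space_symbols[OF assms(1)]])
qed

section \<open>Measurability of the error and complexity events\<close>

lemma borel_measurable_channel:
  assumes "i < nr" "l < nt"
  shows "(\<lambda>\<omega>. fst \<omega> (i,l)) \<in> borel_measurable (chan_measure nr nt T)"
proof -
  have "(\<lambda>H. H (i,l)) \<in> PiM ({..<nr} \<times> {..<nt}) (\<lambda>_. cn_measure) \<rightarrow>\<^sub>M borel"
    unfolding measurable_cong_sets[OF refl sets_cn_measure, symmetric]
    using assms by (intro measurable_component_singleton) auto
  from measurable_compose[OF measurable_fst this] show ?thesis unfolding chan_measure_def .
qed

lemma borel_measurable_noise:
  assumes "i < nr" "t < T"
  shows "(\<lambda>\<omega>. snd \<omega> (i,t)) \<in> borel_measurable (chan_measure nr nt T)"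
proof -
  have "(\<lambda>W. W (i,t)) \<in> PiM ({..<nr} \<times> {..<T}) (\<lambda>_. cn_measure) \<rightarrow>\<^sub>M borel"
    unfolding measurable_cong_sets[OF refl sets_cn_measure, symmetric]
    using assms by (intro measurable_component_singleton) auto
  from measurable_compose[OF measurable_snd this] show ?thesis unfolding chan_measure_def .
qed

lemma borel_measurable_received:
  assumes "i < nr" "t < T"
  shows "(\<lambda>\<omega>. received nt T G \<theta> (fst \<omega>) (snd \<omega>) s (i,t)) \<in> borel_measurable (chan_measure nr nt T)"
  unfolding received_def prod.case using assms
  by (intro borel_measurable_add borel_measurable_sum borel_measurable_times borel_measurable_const
      borel_measurable_channel borel_measurable_noise) auto

lemma borel_measurable_frob_dist2:
  "(\<lambda>\<omega>. frob_dist2 nr nt T (fst \<omega>) (received nt T G \<theta> (fst \<omega>) (snd \<omega>) s) X)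
    \<in> borel_measurable (chan_measure nr nt T)"
  unfolding frob_dist2_def
proof (intro borel_measurable_sum)
  fix i t assume "i \<in> {..<nr}" "t \<in> {..<T}"
  then have "(\<lambda>\<omega>. received nt T G \<theta> (fst \<omega>) (snd \<omega>) s (i,t) - (\<Sum>l<nt. fst \<omega> (i,l) * X (l,t)))
      \<in> borel_measurable (chan_measure nr nt T)"
    by (intro borel_measurable_sum borel_measurable_diff borel_measurable_times
        borel_measurable_const borel_measurable_channel borel_measurable_received) auto
  then show "(\<lambda>\<omega>. (cmod (received nt T G \<theta> (fst \<omega>) (snd \<omega>) s (i,t) -
      (\<Sum>l<nt. fst \<omega> (i,l) * X (l,t))))\<^sup>2) \<in> borel_measurable (chan_measure nr nt T)"
    by measurable
qed

lemma borel_measurable_gs_Nk_chan: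
  assumes "0 < nr"
  shows "(\<lambda>\<omega>. real (gs_Nk (nr*T) (nt*T) (sd_M nr nt G \<theta> (fst \<omega>)) \<eta> \<xi>2
    (vec_Y nr (received nt T G \<theta> (fst \<omega>) (snd \<omega>) s)) k)) \<in> borel_measurable (chan_measure nr nt T)"
proof (rule borel_measurable_gs_Nk)
  fix a j
  show "(\<lambda>\<omega>. sd_M nr nt G \<theta> (fst \<omega>) a j) \<in> borel_measurable (chan_measure nr nt T)"
    unfolding sd_M_def using assms
    by (intro borel_measurable_sum borel_measurable_times borel_measurable_const borel_measurable_channel) auto
next
  fix a assume "a < nr * T"
  then show "(\<lambda>\<omega>. vec_Y nr (received nt T G \<theta> (fst \<omega>) (snd \<omega>) s) a) \<in> borel_measurable (chan_measure nr nt T)"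
    unfolding vec_Y_def using assms
    by (intro borel_measurable_received) (auto simp: less_mult_imp_div_less mult.commute)
qed

lemma sets_ml_error:
  "{\<omega> \<in> space (sys_measure nr nt T \<eta>). case \<omega> of ((H,W),s) \<Rightarrow> ml_error nr nt T G \<eta> \<theta> H W s}
    \<in> sets (sys_measure nr nt T \<eta>)"
proof -
  let ?S = "Pi\<^sub>E {..<nt*T} (\<lambda>_. QAM \<eta>)"
  let ?M = "chan_measure nr nt T \<Otimes>\<^sub>M uniform_count_measure ?S"
  have fin: "finite ?S" by (intro finite_PiE) (auto simp: finite_QAM)
  have "{\<omega> \<in> space ?M. ml_error nr nt T G \<eta> \<theta> (fst (fst \<omega>)) (snd (fst \<omega>)) (snd \<omega>)} \<in> sets ?M"
  proof (rule sets_pair_finite_snd[OF fin])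
    fix s assume "s \<in> ?S"
    have "{x \<in> space (chan_measure nr nt T). ml_error nr nt T G \<eta> \<theta> (fst x) (snd x) s} =
      (\<Union>s'\<in>{s'\<in>?S. \<exists>l<nt. \<exists>t<T. codeword nt T G \<theta> s' (l,t) \<noteq> codeword nt T G \<theta> s (l,t)}.
        {x \<in> space (chan_measure nr nt T).
          frob_dist2 nr nt T (fst x) (received nt T G \<theta> (fst x) (snd x) s) (codeword nt T G \<theta> s')
          \<le> frob_dist2 nr nt T (fst x) (received nt T G \<theta> (fst x) (snd x) s) (codeword nt T G \<theta> s)})"
      unfolding ml_error_def by blast
    also have "\<dots> \<in> sets (chan_measure nr nt T)"
      using fin by (intro sets.finite_UN borel_measurable_le borel_measurable_frob_dist2) auto
    finally show "{x \<in> space (chan_measure nr nt T). ml_error nr nt T G \<eta> \<theta> (fst x) (snd x) s}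
      \<in> sets (chan_measure nr nt T)" .
  qed
  then have "{\<omega> \<in> space (completion ?M). ml_error nr nt T G \<eta> \<theta> (fst (fst \<omega>)) (snd (fst \<omega>)) (snd \<omega>)}
    \<in> sets (completion ?M)" by simp
  then show ?thesis unfolding sys_measure_eq by (simp add: case_prod_unfold)
qed

text \<open>The free index set \<open>K\<close> serves both uses: all layers for the total count,
  and a singleton for the count at the last layer.\<close>

lemma sets_sd_event:
  assumes dims: "0 < nr" "nt \<le> nr" and "0 < \<eta>" "\<theta> \<noteq> 0" and G: "inj_cols (nt*T) (nt*T) G"
  shows "{\<omega> \<in> space (sys_measure nr nt T \<eta>). case \<omega> of ((H,W),s) \<Rightarrow>
      c \<le> (\<Sum>k\<in>K. real (sd_Nk nr nt T G \<eta> \<theta> \<xi>2 H W s k))} \<in> sets (sys_measure nr nt T \<eta>)"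
proof -
  let ?S = "Pi\<^sub>E {..<nt*T} (\<lambda>_. QAM \<eta>)"
  let ?M = "chan_measure nr nt T \<Otimes>\<^sub>M uniform_count_measure ?S"
  let ?g = "\<lambda>x s k. real (gs_Nk (nr*T) (nt*T) (sd_M nr nt G \<theta> (fst x)) \<eta> \<xi>2
    (vec_Y nr (received nt T G \<theta> (fst x) (snd x) s)) k)"
  have fin: "finite ?S" by (intro finite_PiE) (auto simp: finite_QAM)
  have "{\<omega> \<in> space ?M. c \<le> (\<Sum>k\<in>K. ?g (fst \<omega>) (snd \<omega>) k)} \<in> sets ?M"
    by (rule sets_pair_finite_snd[OF fin], intro borel_measurable_le borel_measurable_const
        borel_measurable_sum borel_measurable_gs_Nk_chan[OF dims(1)])
  moreover have "AE \<omega> in ?M.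
      c \<le> (\<Sum>k\<in>K. real (sd_Nk nr nt T G \<eta> \<theta> \<xi>2 (fst (fst \<omega>)) (snd (fst \<omega>)) (snd \<omega>) k)) \<longleftrightarrow>
      c \<le> (\<Sum>k\<in>K. ?g (fst \<omega>) (snd \<omega>) k)"
    using AE_channel_inj[OF \<open>0 < \<eta>\<close> dims(2), of T]
  proof eventually_elim
    case (elim \<omega>)
    from inj_cols_sd_M[OF this G dims(2) \<open>\<theta> \<noteq> 0\<close>] show ?case by (simp add: sd_Nk_eq_gs_Nk)
  qed
  ultimately have "{\<omega> \<in> space (completion ?M).
      c \<le> (\<Sum>k\<in>K. real (sd_Nk nr nt T G \<eta> \<theta> \<xi>2 (fst (fst \<omega>)) (snd (fst \<omega>)) (snd \<omega>) k))} \<in> sets (completion ?M)"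
    by (rule sets_completion_AE_eq[rotated])
  then show ?thesis unfolding sys_measure_eq by (simp add: case_prod_unfold)
qed

section \<open>Probability of an empty search set\<close>

lemma prob_space_sys_measure: "0 < \<eta> \<Longrightarrow> prob_space (sys_measure nr nt T \<eta>)"
  unfolding sys_measure_eq
  by (intro prob_space.prob_space_completion prob_space_pair prob_space_chan_measure prob_space_symbols)

lemma measure_noise_tail:
  fixes nr nt T :: nat and \<eta> \<mu> t :: real
  assumes "0 < \<eta>" "0 \<le> \<mu>" "\<mu> < 1"
  defines "E \<equiv> {\<omega> \<in> space (sys_measure nr nt T \<eta>). t < (\<Sum>p\<in>{..<nr}\<times>{..<T}. (cmod (snd (fst \<omega>) p))\<^sup>2)}"
  shows "E \<in> sets (sys_measure nr nt T \<eta>)"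
    and "measure (sys_measure nr nt T \<eta>) E \<le> exp (- \<mu> * t) * (1 / (1 - \<mu>)) ^ (nr * T)"
proof -
  let ?U = "uniform_count_measure (Pi\<^sub>E {..<nt*T} (\<lambda>_. QAM \<eta>))"
  let ?H = "PiM ({..<nr} \<times> {..<nt}) (\<lambda>_. cn_measure)" and ?W = "PiM ({..<nr} \<times> {..<T}) (\<lambda>_. cn_measure)"
  let ?M = "chan_measure nr nt T \<Otimes>\<^sub>M ?U"
  define F where "F = {W \<in> space ?W. t < (\<Sum>p\<in>{..<nr}\<times>{..<T}. (cmod (W p))\<^sup>2)}"
  interpret H: prob_space ?H by (rule prob_space_cn_PiM)
  interpret W: prob_space ?W by (rule prob_space_cn_PiM)
  interpret U: prob_space ?U by (rule prob_space_symbols[OF assms(1)])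
  have F: "F \<in> sets ?W" unfolding F_def by measurable
  have E: "E = (space ?H \<times> F) \<times> space ?U"
    unfolding E_def F_def sys_measure_eq by (auto simp: space_pair_measure chan_measure_def)
  have EM: "E \<in> sets ?M" unfolding E chan_measure_def using F by (intro pair_measureI) auto
  then show "E \<in> sets (sys_measure nr nt T \<eta>)" unfolding sys_measure_eq by simp
  have "emeasure (sys_measure nr nt T \<eta>) E = emeasure ?M E" unfolding sys_measure_eq using EM by simp
  also have "\<dots> = emeasure ?W F"
    unfolding E chan_measure_def using F
    by (simp add: U.emeasure_pair_measure_Times W.emeasure_pair_measure_Times H.emeasure_space_1 U.emeasure_space_1)
  also have "\<dots> \<le> ennreal (exp (- \<mu> * t) * (1 / (1 - \<mu>)) ^ (nr * T))"
    unfolding F_def using emeasure_cn_PiM_tail[of "{..<nr}\<times>{..<T}" \<mu> t] assms by (simp add: card_cartesian_product)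
  finally show "measure (sys_measure nr nt T \<eta>) E \<le> exp (- \<mu> * t) * (1 / (1 - \<mu>)) ^ (nr * T)"
    unfolding measure_def using assms by (intro enn2real_leI) auto
qed

text \<open>Up to the null set of singular channels, an empty search set lies inside the noise tail
  event with threshold \<open>\<xi>2\<close>.\<close>

lemma measure_sd_empty:
  assumes dims: "0 < nr" "nt \<le> nr" and "0 < \<eta>" "\<theta> \<noteq> 0" and G: "inj_cols (nt*T) (nt*T) G"
    and \<mu>: "0 \<le> \<mu>" "\<mu> < 1"
  shows "measure (sys_measure nr nt T \<eta>) {\<omega> \<in> space (sys_measure nr nt T \<eta>). case \<omega> of ((H,W),s) \<Rightarrow>
      sd_Nk nr nt T G \<eta> \<theta> \<xi>2 H W s (nt*T) = 0} \<le> exp (- \<mu> * \<xi>2) * (1 / (1 - \<mu>)) ^ (nr * T)"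
    (is "measure ?M ?B \<le> _")
proof -
  interpret prob_space ?M by (rule prob_space_sys_measure[OF \<open>0 < \<eta>\<close>])
  let ?E = "{\<omega> \<in> space ?M. \<xi>2 < (\<Sum>p\<in>{..<nr}\<times>{..<T}. (cmod (snd (fst \<omega>) p))\<^sup>2)}"
  have "AE \<omega> in ?M. inj_cols nt nt (\<lambda>i l. fst (fst \<omega>) (i,l))"
    unfolding sys_measure_eq by (rule AE_completion) (rule AE_channel_inj[OF \<open>0 < \<eta>\<close> dims(2)])
  moreover have imp: "\<omega> \<in> ?E" if "inj_cols nt nt (\<lambda>i l. fst (fst \<omega>) (i,l))" "\<omega> \<in> ?B" for \<omega>
  proof -
    have sp: "\<omega> \<in> space ?M" using that(2) by simp
    then have s: "snd \<omega> \<in> Pi\<^sub>E {..<nt*T} (\<lambda>_. QAM \<eta>)"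
      unfolding sys_measure_eq space_completion space_pair_measure space_uniform_count_measure
      by (rule mem_Times_iff[THEN iffD1, THEN conjunct2])
    have "sd_Nk nr nt T G \<eta> \<theta> \<xi>2 (fst (fst \<omega>)) (snd (fst \<omega>)) (snd \<omega>) (nt*T) = 0"
      using that(2) by (simp add: case_prod_unfold)
    from sd_Nk_empty_imp_noise[OF inj_cols_sd_M[OF that(1) G dims(2) \<open>\<theta> \<noteq> 0\<close>] dims(1) s this]
    show ?thesis using sp by simp
  qed
  ultimately have "AE \<omega> in ?M. \<omega> \<in> ?B \<longrightarrow> \<omega> \<in> ?E"
    by (elim eventually_mono) (intro impI imp)
  then have "measure ?M ?B \<le> measure ?M ?E"
    by (rule finite_measure_mono_AE) (rule measure_noise_tail(1)[OF \<open>0 < \<eta>\<close> \<mu>])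
  also have "\<dots> \<le> exp (- \<mu> * \<xi>2) * (1 / (1 - \<mu>)) ^ (nr * T)"
    by (rule measure_noise_tail(2)[OF \<open>0 < \<eta>\<close> \<mu>])
  finally show ?thesis .
qed

section \<open>Exponents and the limit\<close>

text \<open>A finite upper bound on the exponent excludes \<open>P \<rho> = 0\<close>, where the
  exponent is infinite, so logarithms may be undone.\<close>

lemma decay_exp_less_imp:
  assumes "\<rho> > 1" "0 \<le> P \<rho>" "decay_exp P \<rho> < ereal a"
  shows "\<rho> powr (- a) < P \<rho>"
proof -
  have pos: "0 < P \<rho>" using assms by (auto simp: decay_exp_def order_less_le split: if_splits)
  then have "- log 2 (P \<rho>) / log 2 \<rho> < a" using assms by (simp add: decay_exp_def)
  then have "- ln (P \<rho>) < a * ln \<rho>" using assms(1) by (simp add: log_def field_simps)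
  then have "exp (- a * ln \<rho>) < exp (ln (P \<rho>))" by simp
  then show ?thesis using pos assms(1) by (simp add: powr_def)
qed

lemma decay_exp_greater_imp:
  assumes "\<rho> > 1" "0 \<le> P \<rho>" "decay_exp P \<rho> > ereal b"
  shows "P \<rho> \<le> \<rho> powr (- b)"
proof (cases "P \<rho> = 0")
  case False
  then have pos: "0 < P \<rho>" using assms by simp
  then have "- log 2 (P \<rho>) / log 2 \<rho> > b" using assms by (simp add: decay_exp_def)
  then have "- ln (P \<rho>) > b * ln \<rho>" using assms(1) by (simp add: log_def field_simps)
  then have "exp (ln (P \<rho>)) \<le> exp (- b * ln \<rho>)" by simp
  then show ?thesis using pos assms(1) by (simp add: powr_def)
qed simp

text \<open>Lower bound by monotonicity, upper bound by the union bound. Lowering the threshold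
  exponent from \<open>x\<close> to \<open>y\<close> only enlarges the complexity event, which
  allows a \<open>y\<close> with known decay.\<close>

lemma sd_fail_sandwich:
  assumes dims: "1 \<le> nt" "nt \<le> nr" and "1 < \<rho>" "0 < \<eta> \<rho>" "\<theta> \<rho> > 0" and G: "inj_cols (nt*T) (nt*T) G"
    and "y \<le> x"
  shows "Pe_ML nr nt T G \<eta> \<theta> \<rho> \<le> Pr_sd_fail nr nt T G \<eta> \<theta> z x \<rho>"
    and "Pr_sd_fail nr nt T G \<eta> \<theta> z x \<rho> \<le>
      Pe_ML nr nt T G \<eta> \<theta> \<rho> + (1 / (1 - ln 2)) ^ (nr * T) * \<rho> powr (- z)
      + Pr_complexity nr nt T G \<eta> \<theta> z y \<rho>"
proof -
  let ?M = "sys_measure nr nt T (\<eta> \<rho>)" and ?\<xi>2 = "z * log 2 \<rho>"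
  interpret prob_space ?M by (rule prob_space_sys_measure) fact
  have nr: "0 < nr" and th: "\<theta> \<rho> \<noteq> 0" using assms by auto
  define A where "A = {\<omega> \<in> space ?M. case \<omega> of ((H,W),s) \<Rightarrow> ml_error nr nt T G (\<eta> \<rho>) (\<theta> \<rho>) H W s}"
  define B where "B = {\<omega> \<in> space ?M. case \<omega> of ((H,W),s) \<Rightarrow>
    sd_Nk nr nt T G (\<eta> \<rho>) (\<theta> \<rho>) ?\<xi>2 H W s (nt*T) = 0}"
  define C where "C u = {\<omega> \<in> space ?M. case \<omega> of ((H,W),s) \<Rightarrow>
    \<rho> powr u \<le> real (sd_N nr nt T G (\<eta> \<rho>) (\<theta> \<rho>) ?\<xi>2 H W s)}" for u
  have A: "A \<in> sets ?M" unfolding A_def by (rule sets_ml_error)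
  have B: "B \<in> sets ?M"
  proof -
    \<comment> \<open>The count is a natural number, so being zero is the complement of being at
      least 1.\<close>
    have "B = space ?M - {\<omega> \<in> space ?M. case \<omega> of ((H,W),s) \<Rightarrow>
        1 \<le> (\<Sum>k\<in>{nt*T}. real (sd_Nk nr nt T G (\<eta> \<rho>) (\<theta> \<rho>) ?\<xi>2 H W s k))}"
      unfolding B_def by (auto split: prod.splits)
    also have "\<dots> \<in> sets ?M"
      by (intro sets.Diff sets.top sets_sd_event[OF nr dims(2) assms(4) th G])
    finally show ?thesis .
  qed
  have C: "C u \<in> sets ?M" for u
    unfolding C_def sd_N_def of_nat_sum by (rule sets_sd_event[OF nr dims(2) assms(4) th G])
  have fail: "Pr_sd_fail nr nt T G \<eta> \<theta> z x \<rho> = prob (A \<union> B \<union> C x)"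
    unfolding Pr_sd_fail_def Pr_event_def
    by (rule arg_cong[where f = "measure ?M"]) (auto simp: A_def B_def C_def)
  have ml: "Pe_ML nr nt T G \<eta> \<theta> \<rho> = prob A"
    by (simp add: Pe_ML_def Pr_event_def A_def case_prod_unfold)
  have cpl: "Pr_complexity nr nt T G \<eta> \<theta> z y \<rho> = prob (C y)"
    by (simp add: Pr_complexity_def Pr_event_def C_def case_prod_unfold)
  show "Pe_ML nr nt T G \<eta> \<theta> \<rho> \<le> Pr_sd_fail nr nt T G \<eta> \<theta> z x \<rho>"
    unfolding fail ml using A B C by (intro finite_measure_mono) auto
  have "prob (A \<union> B \<union> C x) \<le> prob (A \<union> B) + prob (C x)"
    using A B C by (intro measure_Un_le) auto
  also have "prob (A \<union> B) \<le> prob A + prob B"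
    using A B by (intro measure_Un_le) auto
  also have "prob (C x) \<le> prob (C y)"
  proof (rule finite_measure_mono[OF _ C])
    have "\<rho> powr y \<le> \<rho> powr x" using \<open>1 < \<rho>\<close> \<open>y \<le> x\<close> by (intro powr_mono) auto
    then show "C x \<subseteq> C y" unfolding C_def by auto
  qed
  also have "prob B \<le> (1 / (1 - ln 2)) ^ (nr * T) * \<rho> powr (- z)"
  proof -
    \<comment> \<open>the Chernoff parameter \<open>ln 2 < 1\<close> compensates for the binary logarithm in the radius\<close>
    have "exp (- ln 2 * ?\<xi>2) = \<rho> powr (- z)"
      using \<open>1 < \<rho>\<close> by (simp add: powr_def log_def)
    then show ?thesis
      using measure_sd_empty[OF nr dims(2) assms(4) th G, of "ln 2" ?\<xi>2] ln_2_less_1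
      unfolding B_def by (simp add: mult.commute)
  qed
  finally show "Pr_sd_fail nr nt T G \<eta> \<theta> z x \<rho> \<le>
      Pe_ML nr nt T G \<eta> \<theta> \<rho> + (1 / (1 - ln 2)) ^ (nr * T) * \<rho> powr (- z)
      + Pr_complexity nr nt T G \<eta> \<theta> z y \<rho>"
    unfolding fail ml cpl by linarith
qed

theorem theorem1:
  fixes nt nr T :: nat and r z x :: real
    and G :: "nat \<Rightarrow> nat \<Rightarrow> complex"
    and \<eta> \<theta> :: "real \<Rightarrow> real"
    and d :: ereal and \<Psi> :: "real \<Rightarrow> ereal"
  assumes dims: "1 \<le> nt" "1 \<le> T" "nt \<le> nr"
    and r_range: "0 \<le> r" "r \<le> real nt"
    and G_full_rank: "\<forall>c. (\<forall>a<nt*T. (\<Sum>j<nt*T. G a j * c j) = 0) \<longrightarrow> (\<forall>j<nt*T. c j = 0)"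
    and eta_pos: "\<forall>\<rho>>0. \<eta> \<rho> > 0"
    and theta_pos: "\<forall>\<rho>>0. \<theta> \<rho> > 0"
    and eta_exp: "dot_eq \<eta> (r * real T / (2 * real (nt*T)))"
    and theta_exp: "dot_eq (\<lambda>\<rho>. (\<theta> \<rho>)\<^sup>2) (1 - r * real T / real (nt*T))"
    and d_def: "(decay_exp (Pe_ML nr nt T G \<eta> \<theta>) \<longlongrightarrow> d) at_top"
    and Psi_def: "\<forall>y. (decay_exp (Pr_complexity nr nt T G \<eta> \<theta> z y) \<longlongrightarrow> \<Psi> y) at_top"
    and z_gt: "ereal z > d"
    and x_gt: "ereal x > (INF y\<in>{y. \<Psi> y > d}. ereal y)"
  shows "((\<lambda>\<rho>. Pr_sd_fail nr nt T G \<eta> \<theta> z x \<rho> / Pe_ML nr nt T G \<eta> \<theta> \<rho>) \<longlongrightarrow> 1) at_top"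
proof -
  let ?P = "Pe_ML nr nt T G \<eta> \<theta>"
  have inj: "inj_cols (nt*T) (nt*T) G" using G_full_rank unfolding inj_cols_def .
  \<comment> \<open>Since \<open>x\<close> exceeds the infimum defining the complexity exponent,
    some admissible \<open>y\<close> lies below it.\<close>
  obtain y where y: "\<Psi> y > d" "y \<le> x" using x_gt by (auto simp: INF_less_iff)
  have "d < min (ereal z) (\<Psi> y)" using z_gt y by simp
  \<comment> \<open>The ML error probability eventually exceeds \<open>\<rho> powr (- a)\<close>.
    Both other terms decay strictly faster: the noise term since \<open>a < z\<close>, the
    complexity term through a further exponent \<open>b\<close> between \<open>a\<close> and
    \<open>\<Psi> y\<close>.\<close>
  then obtain a where a: "d < ereal a" "ereal a < ereal z" "ereal a < \<Psi> y"
    by (metis ereal_dense2 min_less_iff_conj)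
  obtain b where b: "ereal a < ereal b" "ereal b < \<Psi> y" using ereal_dense2[OF a(3)] by blast
  let ?C = "(1 / (1 - ln 2)) ^ (nr * T) :: real"
  \<comment> \<open>Bound on the excess relative to the ML error: both error terms divided by
    \<open>\<rho> powr (- a)\<close>.\<close>
  define g where "g \<rho> = ?C * \<rho> powr (a - z) + \<rho> powr (a - b)" for \<rho> :: real
  have "((\<lambda>\<rho>. \<rho> powr (a - z)) \<longlongrightarrow> 0) at_top" "((\<lambda>\<rho>. \<rho> powr (a - b)) \<longlongrightarrow> 0) at_top"
    using a b by (auto intro!: tendsto_neg_powr filterlim_ident)
  then have "((\<lambda>\<rho>. 1 + g \<rho>) \<longlongrightarrow> 1 + (?C * 0 + 0)) at_top"
    unfolding g_def by (intro tendsto_intros)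
  then have lim: "((\<lambda>\<rho>. 1 + g \<rho>) \<longlongrightarrow> 1) at_top" by simp
  have "\<forall>\<^sub>F \<rho> in at_top. decay_exp ?P \<rho> < ereal a" using order_tendstoD(2)[OF d_def a(1)] .
  moreover have "\<forall>\<^sub>F \<rho> in at_top. ereal b < decay_exp (Pr_complexity nr nt T G \<eta> \<theta> z y) \<rho>"
    using order_tendstoD(1)[OF spec[OF Psi_def] b(2)] .
  ultimately have bounds: "\<forall>\<^sub>F \<rho> in at_top. 1 \<le> Pr_sd_fail nr nt T G \<eta> \<theta> z x \<rho> / ?P \<rho> \<and>
      Pr_sd_fail nr nt T G \<eta> \<theta> z x \<rho> / ?P \<rho> \<le> 1 + g \<rho>"
    using eventually_gt_at_top[of 1]
  proof eventually_elim
    case (elim \<rho>)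
    have pos: "\<rho> powr (- a) < ?P \<rho>"
      using decay_exp_less_imp[OF elim(3) _ elim(1)] by (simp add: Pe_ML_def Pr_event_def)
    have C: "Pr_complexity nr nt T G \<eta> \<theta> z y \<rho> \<le> \<rho> powr (- b)"
      using decay_exp_greater_imp[OF elim(3) _ elim(2)] by (simp add: Pr_complexity_def Pr_event_def)
    have P0: "0 < ?P \<rho>" using pos by (meson order_le_less_trans powr_ge_zero)
    \<comment> \<open>Strict positivity of the ML error probability, just shown, makes the division
      below legitimate.\<close>
    note sw = sd_fail_sandwich[OF dims(1,3) elim(3) _ _ inj y(2), where \<eta> = \<eta> and \<theta> = \<theta> and z = z]
    have low: "?P \<rho> \<le> Pr_sd_fail nr nt T G \<eta> \<theta> z x \<rho>" using elim eta_pos theta_pos by (intro sw) auto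
    have "Pr_sd_fail nr nt T G \<eta> \<theta> z x \<rho> \<le>
        ?P \<rho> + ?C * \<rho> powr (- z) + Pr_complexity nr nt T G \<eta> \<theta> z y \<rho>"
      using elim eta_pos theta_pos by (intro sw) auto
    also have "\<dots> \<le> ?P \<rho> + (?C * \<rho> powr (- z) + \<rho> powr (- b))" using C by simp
    also have "?C * \<rho> powr (- z) + \<rho> powr (- b) = g \<rho> * \<rho> powr (- a)"
      using elim(3) by (simp add: g_def distrib_right mult.assoc powr_add[symmetric])
    also have "g \<rho> * \<rho> powr (- a) \<le> g \<rho> * ?P \<rho>"
      using pos ln_2_less_1 by (intro mult_left_mono) (auto simp: g_def)
    finally have "Pr_sd_fail nr nt T G \<eta> \<theta> z x \<rho> \<le> (1 + g \<rho>) * ?P \<rho>" by (simp add: algebra_simps)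
    then show ?case using low P0 by (simp add: field_simps)
  qed
  show ?thesis
    by (rule tendsto_sandwich[OF _ _ tendsto_const lim]) (use bounds in \<open>auto elim: eventually_mono\<close>)
qed

end
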